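(* Let $a,b,c\in\mathbb C$ satisfy $|a|=1$, $\bar ab+\bar b=0$, $|c|^2e^{|b|^2}=1$, let $\mathcal C_{a,b,c}$ be the corresponding weighted composition conjugation on $\mathcal F^2$, and let $W_{\psi,\varphi,\max}$ be the maximal weighted composition operator on $\mathcal F^2$ induced by two entire functions $\psi,\varphi$ with $\psi\not\equiv0$. Then the following assertions are equivalent. (1) The operator $W_{\psi,\varphi,\max}$ is $\mathcal C_{a,b,c}$-selfadjoint. (2) The operator $W_{\psi,\varphi,\max}$ is densely defined and satisfies $W_{\psi,\varphi,\max}^*\preceq\mathcal C_{a,b,c}W_{\psi,\varphi,\max}\mathcal C_{a,b,c}$. (3) There are complex constants $A,B,C,D$ with $C\neq0$ and $D=aB-bA+b$ such that $\varphi(z)=Az+B$ and $\psi(z)=Ce^{Dz}$.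
   Context: The Fock space $\mathcal F^2$ is the Hilbert space of entire functions on $\mathbb C$ that are square integrable with respect to $\frac1\pi e^{-|z|^2}\,dV(z)$ ($dV$ is Lebesgue measure on $\mathbb C$), with inner product $\langle f,g\rangle=\frac1\pi\int_{\mathbb C}f(z)\overline{g(z)}e^{-|z|^2}\,dV(z)$. For entire functions $\psi,\varphi$, put $E(\psi,\varphi)f=\psi\cdot (f\circ\varphi)$. The maximal weighted composition operator $W_{\psi,\varphi,\max}$ has domain $\{f\in\mathcal F^2: E(\psi,\varphi)f\in\mathcal F^2\}$ and acts by $W_{\psi,\varphi,\max}f=E(\psi,\varphi)f$. For $a,b,c$ as in the claim, the weighted composition conjugation is $\mathcal C_{a,b,c}f(z)=ce^{bz}\overline{f(\overline{az+b})}$, $f\in\mathcal F^2$; it is an anti-linear, isometric, involutive map on $\mathcal F^2$ (a conjugation). $F\preceq G$ means that $G$ is an extension of $F$. For everywhere defined bounded (linear or anti-linear) $P,Q$ and an operator $F$, $\operatorname{dom}(PFQ)=\{f: Qf\in\operatorname{dom}(F)\}$ and $(PFQ)f=PF(Qf)$. For a conjugation $\mathcal C$, an operator $T$ is $\mathcal C$-selfadjoint if it is closed, densely defined, linear and $T=\mathcal CT^*\mathcal C$. *)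

theory Defs
  imports "HOL-Complex_Analysis.Complex_Analysis"
begin

definition fock_space :: "(complex \<Rightarrow> complex) set" where
  "fock_space = {f. f holomorphic_on UNIV \<and>
     integrable lborel (\<lambda>z. (cmod (f z))\<^sup>2 * exp (- (cmod z)\<^sup>2))}"

definition fock_inner :: "(complex \<Rightarrow> complex) \<Rightarrow> (complex \<Rightarrow> complex) \<Rightarrow> complex" where
  "fock_inner f g =
     complex_of_real (1 / pi) *
       (LINT z|lborel. f z * cnj (g z) * complex_of_real (exp (- (cmod z)\<^sup>2)))"

definition fock_norm :: "(complex \<Rightarrow> complex) \<Rightarrow> real" where
  "fock_norm f = sqrt (Re (fock_inner f f))"

definition fock_tendsto :: "(nat \<Rightarrow> complex \<Rightarrow> complex) \<Rightarrow> (complex \<Rightarrow> complex) \<Rightarrow> bool" where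
  "fock_tendsto X f \<longleftrightarrow> (\<lambda>n. fock_norm (\<lambda>z. X n z - f z)) \<longlonglongrightarrow> 0"

text \<open>
  A possibly unbounded operator is a domain together with an action. Only the values of the
  action on the domain are meaningful, so equality of operators is \<open>op_eq\<close>, not HOL equality.
\<close>

record fock_op =
  op_dom :: "(complex \<Rightarrow> complex) set"
  op_app :: "(complex \<Rightarrow> complex) \<Rightarrow> (complex \<Rightarrow> complex)"

definition op_extends :: "fock_op \<Rightarrow> fock_op \<Rightarrow> bool"  (infix "\<preceq>\<^sub>o\<^sub>p" 50) where
  "F \<preceq>\<^sub>o\<^sub>p G \<longleftrightarrow> op_dom F \<subseteq> op_dom G \<and> (\<forall>f\<in>op_dom F. op_app G f = op_app F f)"

definition op_eq :: "fock_op \<Rightarrow> fock_op \<Rightarrow> bool" where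
  "op_eq F G \<longleftrightarrow> op_dom F = op_dom G \<and> (\<forall>f\<in>op_dom F. op_app F f = op_app G f)"

definition linear_op :: "fock_op \<Rightarrow> bool" where
  "linear_op T \<longleftrightarrow>
     op_dom T \<subseteq> fock_space \<and> op_app T ` op_dom T \<subseteq> fock_space \<and>
     (\<lambda>z. 0) \<in> op_dom T \<and>
     (\<forall>f\<in>op_dom T. \<forall>g\<in>op_dom T. \<forall>\<alpha> \<beta>.
        (\<lambda>z. \<alpha> * f z + \<beta> * g z) \<in> op_dom T \<and>
        op_app T (\<lambda>z. \<alpha> * f z + \<beta> * g z) = (\<lambda>z. \<alpha> * op_app T f z + \<beta> * op_app T g z))"

definition densely_defined :: "fock_op \<Rightarrow> bool" where
  "densely_defined T \<longleftrightarrow>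
     op_dom T \<subseteq> fock_space \<and>
     (\<forall>f\<in>fock_space. \<forall>\<epsilon>>0. \<exists>g\<in>op_dom T. fock_norm (\<lambda>z. f z - g z) < \<epsilon>)"

definition closed_op :: "fock_op \<Rightarrow> bool" where
  "closed_op T \<longleftrightarrow>
     (\<forall>X. \<forall>f\<in>fock_space. \<forall>g\<in>fock_space.
        (\<forall>n. X n \<in> op_dom T) \<and> fock_tendsto X f \<and> fock_tendsto (\<lambda>n. op_app T (X n)) g
          \<longrightarrow> f \<in> op_dom T \<and> op_app T f = g)"

text \<open>
  The description operator is meaningful when \<open>T\<close> is densely defined, since \<open>h\<close> is then unique.
\<close>

definition adjoint_op :: "fock_op \<Rightarrow> fock_op" where
  "adjoint_op T =
     \<lparr> op_dom = {g \<in> fock_space. \<exists>h\<in>fock_space.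
                   \<forall>f\<in>op_dom T. fock_inner (op_app T f) g = fock_inner f h},
       op_app = (\<lambda>g. THE h. h \<in> fock_space \<and>
                   (\<forall>f\<in>op_dom T. fock_inner (op_app T f) g = fock_inner f h)) \<rparr>"

definition sandwich_op ::
  "((complex \<Rightarrow> complex) \<Rightarrow> (complex \<Rightarrow> complex)) \<Rightarrow> fock_op \<Rightarrow>
   ((complex \<Rightarrow> complex) \<Rightarrow> (complex \<Rightarrow> complex)) \<Rightarrow> fock_op" where
  "sandwich_op P F Q =
     \<lparr> op_dom = {f \<in> fock_space. Q f \<in> op_dom F}, op_app = (\<lambda>f. P (op_app F (Q f))) \<rparr>"

definition conj_selfadjoint ::
  "((complex \<Rightarrow> complex) \<Rightarrow> (complex \<Rightarrow> complex)) \<Rightarrow> fock_op \<Rightarrow> bool" where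
  "conj_selfadjoint J T \<longleftrightarrow>
     closed_op T \<and> densely_defined T \<and> linear_op T \<and> op_eq T (sandwich_op J (adjoint_op T) J)"

definition weighted_comp ::
  "(complex \<Rightarrow> complex) \<Rightarrow> (complex \<Rightarrow> complex) \<Rightarrow> (complex \<Rightarrow> complex) \<Rightarrow> (complex \<Rightarrow> complex)" where
  "weighted_comp \<psi> \<phi> f = (\<lambda>z. \<psi> z * f (\<phi> z))"

definition W_max :: "(complex \<Rightarrow> complex) \<Rightarrow> (complex \<Rightarrow> complex) \<Rightarrow> fock_op" where
  "W_max \<psi> \<phi> =
     \<lparr> op_dom = {f \<in> fock_space. weighted_comp \<psi> \<phi> f \<in> fock_space},
       op_app = weighted_comp \<psi> \<phi> \<rparr>"

definition wc_conj ::
  "complex \<Rightarrow> complex \<Rightarrow> complex \<Rightarrow> (complex \<Rightarrow> complex) \<Rightarrow> (complex \<Rightarrow> complex)" where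
  "wc_conj a b c f = (\<lambda>z. c * exp (b * z) * cnj (f (cnj (a * z + b))))"

end

theory Submission
  imports Defs "HOL-Probability.Distributions"
begin

text \<open>
  If the adjoint is contained in the conjugated operator, comparing both on the kernels
  \<open>exp (cnj w * z)\<close> gives a functional equation for \<open>\<psi>\<close> and \<open>\<phi>\<close> that only exponential and affine
  functions solve. Conversely, for \<open>\<psi>(z) = C exp (D z)\<close> and \<open>\<phi>(z) = A z + B\<close> the adjoint of the
  maximal operator is the maximal operator \<open>S\<close> with weight \<open>cnj C exp (cnj B z)\<close> and symbol
  \<open>cnj A z + cnj D\<close>, and the relation between \<open>D\<close> and \<open>A, B\<close> says that the conjugation intertwines
  the two. Testing against kernels shows that the adjoint is contained in \<open>S\<close>. The reverse inclusion
  is a duality on the full maximal domains: it is checked on the polynomials \<open>(z - B)\<^sup>n\<close>, extended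
  to the dilates \<open>f(r z + (1 - r) B)\<close> with \<open>r < 1\<close> by expanding them around \<open>B\<close>, and passed to the
  limit \<open>r \<longlongrightarrow> 1\<close>.
\<close>

section \<open>Measure-preserving maps of the plane\<close>

text \<open>For \<open>|A| > 1\<close> the operator \<open>T\<close> is unbounded, so
  \<open><T f, g> = <f, S g>\<close> on a dense set of \<open>f\<close> does not extend by
  continuity: \<open>f\<close> and \<open>T f\<close> have to be approximated together. Dilations do
  this, and the centre \<open>B\<close> is dictated by the symbol, since the dilation about
  \<open>B\<close> after \<open>\<phi>\<close> equals \<open>\<phi>\<close> after the dilation about
  0. A dilate grows with an exponent strictly below the critical \<open>|z|^2 / 2\<close>, which is
  what makes its Taylor series integrable term by term; the ratio is written \<open>s^2\<close>
  because one factor \<open>s\<close> pays for Cauchy's inequality and the other for a geometric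
  series. The way back to ratio 1 uses that the norms of the dilates are bounded by a factor tending
  to 1, which together with pointwise convergence forces convergence in norm. The identity on the
  polynomials compares the coefficients of two generating functions, both evaluated by the
  reproducing property.\<close>

lemma borel_measurable_Complex [measurable]:
  "(\<lambda>p. Complex (fst p) (snd p)) \<in> borel_measurable (lborel \<Otimes>\<^sub>M lborel)"
proof -
  have "(\<lambda>p. Complex (fst p) (snd p)) = (\<lambda>p. complex_of_real (fst p) + \<i> * complex_of_real (snd p))"
    by (simp add: complex_eq_iff fun_eq_iff)
  then show ?thesis by simp
qed

text \<open>Lebesgue measure is determined by the volumes of boxes, and a box in the plane pulls
  back to a product of two intervals. This opens the plane to Tonelli in real and imaginary
  coordinates.\<close>

lemma lborel_complex_eq:
  "lborel = distr (lborel \<Otimes>\<^sub>M lborel) borel (\<lambda>p. Complex (fst p) (snd p))"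
proof (rule lborel_eqI)
  fix l u :: complex
  assume "\<And>b. b \<in> Basis \<Longrightarrow> l \<bullet> b \<le> u \<bullet> b"
  from this[of 1] this[of \<i>] have le: "Re l \<le> Re u" "Im l \<le> Im u"
    by (auto simp: Basis_complex_def)
  have "(\<lambda>p. Complex (fst p) (snd p)) -` box l u \<inter> space (lborel \<Otimes>\<^sub>M lborel)
        = {Re l<..<Re u} \<times> {Im l<..<Im u}"
    by (auto simp: box_def Basis_complex_def space_pair_measure)
  then show "emeasure (distr (lborel \<Otimes>\<^sub>M lborel) borel (\<lambda>p. Complex (fst p) (snd p))) (box l u)
      = (\<Prod>b\<in>Basis. (u - l) \<bullet> b)"
    using le by (simp add: emeasure_distr lborel.emeasure_pair_measure_Times Basis_complex_def
        complex_eq_iff ennreal_mult)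
qed simp

lemma nn_integral_lborel_complex:
  assumes [measurable]: "f \<in> borel_measurable borel"
  shows "(\<integral>\<^sup>+z. f z \<partial>lborel) = (\<integral>\<^sup>+x. \<integral>\<^sup>+y. f (Complex x y) \<partial>lborel \<partial>lborel)"
    and "(\<integral>\<^sup>+z. f z \<partial>lborel) = (\<integral>\<^sup>+y. \<integral>\<^sup>+x. f (Complex x y) \<partial>lborel \<partial>lborel)"
proof -
  have *: "(\<integral>\<^sup>+z. f z \<partial>lborel) = (\<integral>\<^sup>+p. f (Complex (fst p) (snd p)) \<partial>(lborel \<Otimes>\<^sub>M lborel))"
    by (subst lborel_complex_eq) (simp add: nn_integral_distr)
  show "(\<integral>\<^sup>+z. f z \<partial>lborel) = (\<integral>\<^sup>+x. \<integral>\<^sup>+y. f (Complex x y) \<partial>lborel \<partial>lborel)"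
    using lborel.nn_integral_fst[of "\<lambda>p. f (Complex (fst p) (snd p))" lborel] * by simp
  show "(\<integral>\<^sup>+z. f z \<partial>lborel) = (\<integral>\<^sup>+y. \<integral>\<^sup>+x. f (Complex x y) \<partial>lborel \<partial>lborel)"
    using lborel_pair.nn_integral_snd[of "\<lambda>p. f (Complex (fst p) (snd p))"] *
    by (simp add: split_def)
qed

lemma nn_integral_lborel_translate:
  fixes f :: "'a :: euclidean_space \<Rightarrow> ennreal"
  assumes [measurable]: "f \<in> borel_measurable borel"
  shows "(\<integral>\<^sup>+x. f (c + x) \<partial>lborel) = (\<integral>\<^sup>+x. f x \<partial>lborel)"
proof -
  have "(\<integral>\<^sup>+x. f x \<partial>lborel) = (\<integral>\<^sup>+x. f x \<partial>(distr lborel borel ((+) c)))"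
    by (simp add: lborel_distr_plus)
  then show ?thesis by (simp add: nn_integral_distr)
qed

lemma nn_integral_lborel_uminus:
  fixes f :: "real \<Rightarrow> ennreal"
  assumes [measurable]: "f \<in> borel_measurable borel"
  shows "(\<integral>\<^sup>+x. f (- x) \<partial>lborel) = (\<integral>\<^sup>+x. f x \<partial>lborel)"
proof -
  have "(\<integral>\<^sup>+x. f x \<partial>lborel) = (\<integral>\<^sup>+x. f x \<partial>(distr lborel borel uminus))"
    by (simp add: lborel_distr_uminus)
  then show ?thesis by (simp add: nn_integral_distr)
qed

text \<open>Meant for translations, rotations and \<open>cnj\<close>, whose composition
  \<open>z -> cnj (a * z + b)\<close> underlies the conjugation.\<close>

definition lborel_preserving :: "(complex \<Rightarrow> complex) \<Rightarrow> bool" where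
  "lborel_preserving T \<longleftrightarrow> T \<in> borel_measurable borel \<and> distr lborel borel T = lborel"

lemma lborel_preservingI:
  assumes [measurable]: "T \<in> borel_measurable borel"
    and "\<And>f. f \<in> borel_measurable borel \<Longrightarrow> (\<integral>\<^sup>+z. f (T z) \<partial>lborel) = (\<integral>\<^sup>+z. f z \<partial>lborel)"
  shows "lborel_preserving T"
  unfolding lborel_preserving_def
proof (intro conjI measure_eqI)
  fix X assume X: "X \<in> sets (distr lborel borel T)"
  then have [measurable]: "X \<in> sets borel" by simp
  have "emeasure (distr lborel borel T) X = (\<integral>\<^sup>+z. indicator X (T z) \<partial>lborel)"
    using X by (simp add: nn_integral_distr flip: nn_integral_indicator)
  also have "\<dots> = emeasure lborel X"
    using X by (subst assms(2)) auto
  finally show "emeasure (distr lborel borel T) X = emeasure lborel X" .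
qed simp_all

lemma lborel_preserving_compose:
  assumes "lborel_preserving S" "lborel_preserving T"
  shows "lborel_preserving (\<lambda>z. S (T z))"
proof -
  have [measurable]: "S \<in> borel_measurable borel" "T \<in> borel_measurable borel"
    using assms by (auto simp: lborel_preserving_def)
  have "distr lborel borel (\<lambda>z. S (T z)) = distr (distr lborel borel T) borel S"
    by (simp add: distr_distr comp_def)
  then show ?thesis
    using assms by (simp add: lborel_preserving_def)
qed

lemma lborel_preserving_translate: "lborel_preserving (\<lambda>z. z + w)"
  by (rule lborel_preservingI) (simp_all add: nn_integral_lborel_translate add.commute[of _ w])

lemma lborel_preserving_cnj: "lborel_preserving cnj"
proof (rule lborel_preservingI)
  show [measurable]: "cnj \<in> borel_measurable borel"
    by (intro borel_measurable_continuous_onI continuous_intros)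
  fix f :: "complex \<Rightarrow> ennreal" assume [measurable]: "f \<in> borel_measurable borel"
  have [measurable]: "(\<lambda>y. f (Complex x y)) \<in> borel_measurable borel" for x
    by (rule measurable_compose[OF _ \<open>f \<in> borel_measurable borel\<close>])
       (simp add: Complex_eq)
  show "(\<integral>\<^sup>+z. f (cnj z) \<partial>lborel) = (\<integral>\<^sup>+z. f z \<partial>lborel)"
    using nn_integral_lborel_uminus[of "\<lambda>y. f (Complex x y)" for x]
    by (simp add: nn_integral_lborel_complex(1) complex_cnj)
qed

text \<open>On the line \<open>Re z = x\<close> the shear is translation by \<open>t * x\<close>, so
  integrating over the imaginary part first reduces it to translation invariance.\<close>

lemma lborel_preserving_shear_Im: "lborel_preserving (\<lambda>z. Complex (Re z) (Im z + t * Re z))"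
proof (rule lborel_preservingI)
  show [measurable]: "(\<lambda>z. Complex (Re z) (Im z + t * Re z)) \<in> borel_measurable borel"
    by (simp add: Complex_eq)
  fix f :: "complex \<Rightarrow> ennreal" assume [measurable]: "f \<in> borel_measurable borel"
  have [measurable]: "(\<lambda>y. f (Complex x y)) \<in> borel_measurable borel" for x
    by (rule measurable_compose[OF _ \<open>f \<in> borel_measurable borel\<close>])
       (simp add: Complex_eq)
  show "(\<integral>\<^sup>+z. f (Complex (Re z) (Im z + t * Re z)) \<partial>lborel) = (\<integral>\<^sup>+z. f z \<partial>lborel)"
    using nn_integral_lborel_translate[of "\<lambda>y. f (Complex x y)" "t * x" for x]
    by (simp add: nn_integral_lborel_complex(1) add.commute)
qed

lemma lborel_preserving_shear_Re: "lborel_preserving (\<lambda>z. Complex (Re z + t * Im z) (Im z))"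
proof (rule lborel_preservingI)
  show [measurable]: "(\<lambda>z. Complex (Re z + t * Im z) (Im z)) \<in> borel_measurable borel"
    by (simp add: Complex_eq)
  fix f :: "complex \<Rightarrow> ennreal" assume [measurable]: "f \<in> borel_measurable borel"
  have [measurable]: "(\<lambda>x. f (Complex x y)) \<in> borel_measurable borel" for y
    by (rule measurable_compose[OF _ \<open>f \<in> borel_measurable borel\<close>])
       (simp add: Complex_eq)
  show "(\<integral>\<^sup>+z. f (Complex (Re z + t * Im z) (Im z)) \<partial>lborel) = (\<integral>\<^sup>+z. f z \<partial>lborel)"
    using nn_integral_lborel_translate[of "\<lambda>x. f (Complex x y)" "t * y" for y]
    by (simp add: nn_integral_lborel_complex(2) add.commute)
qed

lemma lborel_preserving_uminus: "lborel_preserving uminus"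
proof -
  have "distr lborel borel uminus = (lborel :: complex measure)"
    by (subst lborel_affine[of "-1" 0]) (auto simp: density_1 one_ennreal_def[symmetric])
  then show ?thesis by (simp add: lborel_preserving_def)
qed

lemma lborel_preserving_rotate:
  assumes "cmod a = 1"
  shows "lborel_preserving (\<lambda>z. a * z)"
proof (cases "Re a = -1")
  case True
  then have "a = -1"
    using assms by (simp add: cmod_def complex_eq_iff)
  then show ?thesis using lborel_preserving_uminus by simp
next
  case False
  \<comment> \<open>For \<open>a = cis \<theta>\<close> this is \<open>- tan (\<theta> / 2)\<close>,
    which exists unless \<open>a = -1\<close>.\<close>
  define t where "t = - Im a / (1 + Re a)"
  have *: "(Re a)\<^sup>2 + (Im a)\<^sup>2 = 1"
    using assms by (simp add: cmod_def)
  have nz: "1 + Re a \<noteq> 0" using False by auto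
  have eqs: "1 + t * Im a = Re a" "t + Re a * t = - Im a"
  proof -
    show 1: "1 + t * Im a = Re a"
      using nz * by (simp add: t_def field_simps power2_eq_square)
    have "t * (1 + Re a) = - Im a"
      using nz by (simp add: t_def)
    then show "t + Re a * t = - Im a"
      by (simp add: algebra_simps)
  qed
  \<comment> \<open>A rotation by an angle other than pi is a product of three shears.\<close>
  have "(\<lambda>z. a * z) = (\<lambda>z. (\<lambda>z. Complex (Re z + t * Im z) (Im z))
      ((\<lambda>z. Complex (Re z) (Im z + Im a * Re z)) ((\<lambda>z. Complex (Re z + t * Im z) (Im z)) z)))"
  proof
    fix z
    have "Re z + t * Im z + t * (Im z + Im a * (Re z + t * Im z))
        = (1 + t * Im a) * Re z + (t + (1 + t * Im a) * t) * Im z"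
      by (simp add: algebra_simps)
    moreover have "Im z + Im a * (Re z + t * Im z) = Im a * Re z + (1 + t * Im a) * Im z"
      by (simp add: algebra_simps)
    ultimately show "a * z = (\<lambda>z. Complex (Re z + t * Im z) (Im z))
      ((\<lambda>z. Complex (Re z) (Im z + Im a * Re z)) ((\<lambda>z. Complex (Re z + t * Im z) (Im z)) z))"
      by (simp add: complex_eq_iff eqs)
  qed
  then show ?thesis
    using lborel_preserving_compose[OF lborel_preserving_shear_Re[of t]
        lborel_preserving_compose[OF lborel_preserving_shear_Im[of "Im a"] lborel_preserving_shear_Re[of t]]]
    by simp
qed

lemma integrable_lborel_preserving_iff:
  fixes f :: "complex \<Rightarrow> 'b :: {banach, second_countable_topology}"
  assumes "lborel_preserving T" and [measurable]: "f \<in> borel_measurable borel"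
  shows "integrable lborel (\<lambda>z. f (T z)) \<longleftrightarrow> integrable lborel f"
proof -
  have [measurable]: "T \<in> borel_measurable borel"
    using assms by (simp add: lborel_preserving_def)
  have "integrable lborel f \<longleftrightarrow> integrable (distr lborel borel T) f"
    using assms by (simp add: lborel_preserving_def)
  then show ?thesis by (simp add: integrable_distr_eq)
qed

lemma integral_lborel_preserving:
  fixes f :: "complex \<Rightarrow> 'b :: {banach, second_countable_topology}"
  assumes "lborel_preserving T" and [measurable]: "f \<in> borel_measurable borel"
  shows "(LINT z|lborel. f (T z)) = (LINT z|lborel. f z)"
proof -
  have [measurable]: "T \<in> borel_measurable borel"
    using assms by (simp add: lborel_preserving_def)
  have "(LINT z|lborel. f z) = (LINT z|distr lborel borel T. f z)"
    using assms by (simp add: lborel_preserving_def)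
  then show ?thesis by (simp add: integral_distr)
qed

lemma lborel_complex_scale:
  assumes "r > 0"
  shows "lborel = density (distr lborel borel (\<lambda>z. complex_of_real r * z + w)) (\<lambda>_. ennreal (r\<^sup>2))"
  using lborel_affine[of r w] assms
  by (simp add: scaleR_conv_of_real add.commute ennreal_power)

lemma integrable_lborel_scale:
  fixes f :: "complex \<Rightarrow> real"
  assumes "r > 0" and int: "integrable lborel f"
  shows "integrable lborel (\<lambda>z. f (complex_of_real r * z + w))"
    and "(LINT z|lborel. f (complex_of_real r * z + w)) = (LINT z|lborel. f z) / r\<^sup>2"
proof -
  have [measurable]: "f \<in> borel_measurable borel" using int by auto
  have 1: "integrable (density (distr lborel borel (\<lambda>z. complex_of_real r * z + w)) (\<lambda>_. ennreal (r\<^sup>2))) f"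
    using int by (subst lborel_complex_scale[OF \<open>r > 0\<close>, symmetric])
  then have "integrable lborel (\<lambda>z. r\<^sup>2 * f (complex_of_real r * z + w))"
    by (simp add: integrable_density integrable_distr_eq)
  then show "integrable lborel (\<lambda>z. f (complex_of_real r * z + w))"
    using assms by simp
  have "(LINT z|lborel. f z) =
     (LINT z|density (distr lborel borel (\<lambda>z. complex_of_real r * z + w)) (\<lambda>_. ennreal (r\<^sup>2)). f z)"
    by (subst lborel_complex_scale[OF \<open>r > 0\<close>, symmetric]) simp
  also have "\<dots> = r\<^sup>2 * (LINT z|lborel. f (complex_of_real r * z + w))"
    by (simp add: integral_density integral_distr)
  finally show "(LINT z|lborel. f (complex_of_real r * z + w)) = (LINT z|lborel. f z) / r\<^sup>2"
    using assms by (simp add: field_simps)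
qed

section \<open>Gaussian integrals over the line and the plane\<close>

lemma nn_integral_gaussian_real: "(\<integral>\<^sup>+x. ennreal (exp (- x\<^sup>2)) \<partial>lborel) = ennreal (sqrt pi)"
proof -
  have "has_bochner_integral lborel (\<lambda>x. exp (- x\<^sup>2) :: real) (2 * (sqrt pi / 2))"
    using has_bochner_integral_even_function[OF gaussian_moment_0] by simp
  then show ?thesis
    by (subst nn_integral_eq_integral)
       (auto simp: has_bochner_integral_iff)
qed

lemma nn_integral_gaussian_complex:
  "(\<integral>\<^sup>+z. ennreal (exp (- (cmod z)\<^sup>2)) \<partial>lborel) = ennreal pi"
proof -
  have "(\<integral>\<^sup>+z. (\<Prod>b\<in>Basis. ennreal (exp (- ((z::complex) \<bullet> b)\<^sup>2))) \<partial>lborel)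
      = (\<Prod>b\<in>(Basis :: complex set). (\<integral>\<^sup>+x. ennreal (exp (- x\<^sup>2)) \<partial>lborel))"
    by (rule nn_integral_lborel_prod) auto
  also have "\<dots> = ennreal pi"
    by (simp add: nn_integral_gaussian_real) (simp add: power2_eq_square flip: ennreal_mult)
  finally have "(\<integral>\<^sup>+z. (\<Prod>b\<in>Basis. ennreal (exp (- ((z::complex) \<bullet> b)\<^sup>2))) \<partial>lborel) = ennreal pi" .
  then show ?thesis
    by (simp add: Basis_complex_def complex_eq_iff cmod_power2 exp_add exp_diff exp_minus
        divide_inverse ennreal_mult mult.commute)
qed

section \<open>The Gaussian measure and square integrability\<close>

lemma borel_measurable_cnj [measurable (raw)]:
  "f \<in> borel_measurable M \<Longrightarrow> (\<lambda>x. cnj (f x)) \<in> borel_measurable M"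
  by (erule measurable_compose) (intro borel_measurable_continuous_onI continuous_intros)

lemma L2_mult_integrable:
  fixes f g :: "'a \<Rightarrow> complex"
  assumes [measurable]: "f \<in> borel_measurable M" "g \<in> borel_measurable M"
    and f: "integrable M (\<lambda>x. (cmod (f x))\<^sup>2)" and g: "integrable M (\<lambda>x. (cmod (g x))\<^sup>2)"
  shows "integrable M (\<lambda>x. f x * cnj (g x))"
proof (rule Bochner_Integration.integrable_bound)
  show "integrable M (\<lambda>x. (cmod (f x))\<^sup>2 + (cmod (g x))\<^sup>2)"
    using f g by simp
  have "cmod u * cmod v \<le> (cmod u)\<^sup>2 + (cmod v)\<^sup>2" for u v
    using sum_squares_bound[of "cmod u" "cmod v"] mult_nonneg_nonneg[OF norm_ge_zero[of u] norm_ge_zero[of v]]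
    by linarith
  then show "AE x in M. norm (f x * cnj (g x)) \<le> norm ((cmod (f x))\<^sup>2 + (cmod (g x))\<^sup>2)"
    by (auto simp: norm_mult)
qed measurable

lemma L2_Cauchy_Schwarz:
  fixes f g :: "'a \<Rightarrow> complex"
  assumes [measurable]: "f \<in> borel_measurable M" "g \<in> borel_measurable M"
    and f: "integrable M (\<lambda>x. (cmod (f x))\<^sup>2)" and g: "integrable M (\<lambda>x. (cmod (g x))\<^sup>2)"
  shows "cmod (LINT x|M. f x * cnj (g x)) \<le>
     sqrt (LINT x|M. (cmod (f x))\<^sup>2) * sqrt (LINT x|M. (cmod (g x))\<^sup>2)"
proof -
  have int: "integrable M (\<lambda>x. cmod (f x) * cmod (g x))"
    using integrable_norm[OF L2_mult_integrable[OF assms]] by (simp add: norm_mult)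
  have "(ennreal (LINT x|M. cmod (f x) * cmod (g x)))\<^sup>2 = (\<integral>\<^sup>+x. ennreal (cmod (f x)) * ennreal (cmod (g x)) \<partial>M)\<^sup>2"
    using int by (subst nn_integral_eq_integral[symmetric]) (auto simp: ennreal_mult)
  also have "\<dots> \<le> (\<integral>\<^sup>+x. ennreal (cmod (f x)) ^ 2 \<partial>M) * (\<integral>\<^sup>+x. ennreal (cmod (g x)) ^ 2 \<partial>M)"
    by (rule Cauchy_Schwarz_nn_integral) auto
  also have "\<dots> = ennreal ((LINT x|M. (cmod (f x))\<^sup>2) * (LINT x|M. (cmod (g x))\<^sup>2))"
    using f g by (simp add: ennreal_power nn_integral_eq_integral ennreal_mult)
  finally have "(LINT x|M. cmod (f x) * cmod (g x))\<^sup>2 \<le> (LINT x|M. (cmod (f x))\<^sup>2) * (LINT x|M. (cmod (g x))\<^sup>2)"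
    by (simp add: ennreal_power)
  then have "LINT x|M. cmod (f x) * cmod (g x) \<le> sqrt ((LINT x|M. (cmod (f x))\<^sup>2) * (LINT x|M. (cmod (g x))\<^sup>2))"
    by (rule real_le_rsqrt)
  moreover have "cmod (LINT x|M. f x * cnj (g x)) \<le> (LINT x|M. cmod (f x) * cmod (g x))"
    using integral_norm_bound[of M "\<lambda>x. f x * cnj (g x)"] by (simp add: norm_mult)
  ultimately show ?thesis by (simp add: real_sqrt_mult)
qed

lemma cmod_diff_squared_le: "(cmod (u - v))\<^sup>2 \<le> 2 * (cmod u)\<^sup>2 + 2 * (cmod v)\<^sup>2"
proof -
  have "(cmod (u - v))\<^sup>2 \<le> (cmod u + cmod v)\<^sup>2"
    by (intro power_mono norm_triangle_ineq4) simp
  also have "\<dots> \<le> 2 * (cmod u)\<^sup>2 + 2 * (cmod v)\<^sup>2"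
    using sum_squares_bound[of "cmod u" "cmod v"] by (simp add: power2_sum)
  finally show ?thesis .
qed

lemma L2_diff_integrable:
  fixes f g :: "'a \<Rightarrow> complex"
  assumes [measurable]: "f \<in> borel_measurable M" "g \<in> borel_measurable M"
    and f: "integrable M (\<lambda>x. (cmod (f x))\<^sup>2)" and g: "integrable M (\<lambda>x. (cmod (g x))\<^sup>2)"
  shows "integrable M (\<lambda>x. (cmod (f x - g x))\<^sup>2)"
  by (rule Bochner_Integration.integrable_bound[of _ "\<lambda>x. 2 * (cmod (f x))\<^sup>2 + 2 * (cmod (g x))\<^sup>2"])
     (use f g cmod_diff_squared_le in auto)

text \<open>
  The Riesz--Scheffe criterion for L2. The part of \<open>|h\<^sub>n - h|\<^sup>2\<close> above
  \<open>2 ||h\<^sub>n|\<^sup>2 - |h|\<^sup>2|\<close> is dominated by \<open>4 |h|\<^sup>2\<close>, and Scheffe's lemma handles the rest.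
\<close>

lemma L2_tendsto_of_norm_bound:
  fixes h :: "'a \<Rightarrow> complex" and H :: "nat \<Rightarrow> 'a \<Rightarrow> complex"
  assumes [measurable]: "\<And>n. H n \<in> borel_measurable M" "h \<in> borel_measurable M"
    and H: "\<And>n. integrable M (\<lambda>x. (cmod (H n x))\<^sup>2)" and h: "integrable M (\<lambda>x. (cmod (h x))\<^sup>2)"
    and lim: "\<And>x. (\<lambda>n. H n x) \<longlonglongrightarrow> h x"
    and bound: "\<And>n. (LINT x|M. (cmod (H n x))\<^sup>2) \<le> k n * (LINT x|M. (cmod (h x))\<^sup>2)"
    and k: "k \<longlonglongrightarrow> 1"
  shows "(\<lambda>n. LINT x|M. (cmod (H n x - h x))\<^sup>2) \<longlonglongrightarrow> 0"
proof -
  define u where "u n x = \<bar>(cmod (H n x))\<^sup>2 - (cmod (h x))\<^sup>2\<bar>" for n x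
  define v where "v n x = max 0 ((cmod (H n x - h x))\<^sup>2 - 2 * u n x)" for n x
  have [measurable]: "u n \<in> borel_measurable M" "v n \<in> borel_measurable M" for n
    unfolding u_def v_def by measurable
  have u_int: "integrable M (u n)" for n
    unfolding u_def using H h by (intro integrable_abs Bochner_Integration.integrable_diff) auto
  have "(\<lambda>n. \<integral>\<^sup>+x. norm ((cmod (H n x))\<^sup>2 - (cmod (h x))\<^sup>2) \<partial>M) \<longlonglongrightarrow> 0"
  proof (rule Scheffe_lemma1[OF H h])
    show "AE x in M. (\<lambda>n. (cmod (H n x))\<^sup>2) \<longlonglongrightarrow> (cmod (h x))\<^sup>2"
      by (intro AE_I2 tendsto_power tendsto_norm lim)
    let ?I = "LINT x|M. (cmod (h x))\<^sup>2"
    \<comment> \<open>Scheffe's lemma asks for a bound on the limsup of the norms;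
      \<open>bound\<close> supplies it because \<open>k\<close> tends to 1.\<close>
    have "(\<lambda>n. ennreal (k n * ?I)) \<longlonglongrightarrow> ennreal (1 * ?I)"
      by (intro tendsto_ennrealI tendsto_mult k tendsto_const)
    then have "limsup (\<lambda>n. ennreal (k n * ?I)) = ennreal ?I"
      by (simp add: tendsto_iff_Liminf_eq_Limsup)
    moreover have "limsup (\<lambda>n. \<integral>\<^sup>+x. norm ((cmod (H n x))\<^sup>2) \<partial>M) \<le> limsup (\<lambda>n. ennreal (k n * ?I))"
      using bound H by (intro Limsup_mono always_eventually)
        (auto simp: nn_integral_eq_integral intro: ennreal_leI)
    ultimately show "limsup (\<lambda>n. \<integral>\<^sup>+x. norm ((cmod (H n x))\<^sup>2) \<partial>M) \<le> (\<integral>\<^sup>+x. norm ((cmod (h x))\<^sup>2) \<partial>M)"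
      using h by (simp add: nn_integral_eq_integral)
  qed
  then have "(\<lambda>n. ennreal (LINT x|M. u n x)) \<longlonglongrightarrow> ennreal 0"
    using u_int[unfolded u_def] by (simp add: nn_integral_eq_integral u_def)
  moreover have "0 \<le> (LINT x|M. u n x)" for n
    by (rule Bochner_Integration.integral_nonneg) (simp add: u_def)
  ultimately have u_lim: "(\<lambda>n. LINT x|M. u n x) \<longlonglongrightarrow> 0"
    using tendsto_ennreal_iff[of "\<lambda>n. LINT x|M. u n x" sequentially 0] by simp
  have v_bound: "v n x \<le> 4 * (cmod (h x))\<^sup>2" for n x
  proof -
    have "(cmod (H n x))\<^sup>2 \<le> u n x + (cmod (h x))\<^sup>2" by (simp add: u_def)
    then show ?thesis
      using cmod_diff_squared_le[of "H n x" "h x"] by (simp add: v_def)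
  qed
  have v_int: "integrable M (v n)" for n
    by (rule Bochner_Integration.integrable_bound[of _ "\<lambda>x. 4 * (cmod (h x))\<^sup>2"])
       (use h v_bound in \<open>auto simp: v_def\<close>)
  have v_lim: "(\<lambda>n. LINT x|M. v n x) \<longlonglongrightarrow> (LINT x|M. 0)"
  proof (rule integral_dominated_convergence[where w = "\<lambda>x. 4 * (cmod (h x))\<^sup>2"])
    show "AE x in M. (\<lambda>n. v n x) \<longlonglongrightarrow> 0"
    proof (rule AE_I2)
      fix x
      have "(\<lambda>n. v n x) \<longlonglongrightarrow> max 0 ((cmod (h x - h x))\<^sup>2 - 2 * \<bar>(cmod (h x))\<^sup>2 - (cmod (h x))\<^sup>2\<bar>)"
        unfolding v_def u_def by (intro tendsto_intros lim)
      then show "(\<lambda>n. v n x) \<longlonglongrightarrow> 0" by simp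
    qed
    have "0 \<le> v n x" for n x by (simp add: v_def)
    then show "AE x in M. norm (v n x) \<le> 4 * (cmod (h x))\<^sup>2" for n
      using v_bound[of n] by (auto simp: abs_of_nonneg)
  qed (use h in auto)
  show ?thesis
  proof (rule tendsto_sandwich[where f = "\<lambda>_. 0"])
    show "\<forall>\<^sub>F n in sequentially. (LINT x|M. (cmod (H n x - h x))\<^sup>2) \<le> (LINT x|M. v n x) + 2 * (LINT x|M. u n x)"
    proof (rule always_eventually, rule allI)
      fix n
      have "(LINT x|M. (cmod (H n x - h x))\<^sup>2) \<le> (LINT x|M. v n x + 2 * u n x)"
        by (intro integral_mono L2_diff_integrable H h Bochner_Integration.integrable_add v_int)
           (use u_int in \<open>auto simp: v_def\<close>)
      then show "(LINT x|M. (cmod (H n x - h x))\<^sup>2) \<le> (LINT x|M. v n x) + 2 * (LINT x|M. u n x)"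
        using u_int v_int by simp
    qed
    show "(\<lambda>n. (LINT x|M. v n x) + 2 * (LINT x|M. u n x)) \<longlonglongrightarrow> 0"
      using tendsto_add[OF v_lim tendsto_mult[OF tendsto_const u_lim, of 2]] by simp
  qed simp_all
qed

text \<open>Domination is asked of the partial sums, which is the form in which the exponential and
  Taylor estimates below arrive. Each single term is then integrable as a difference of consecutive
  partial sums.\<close>

lemma sums_integral_dominated:
  fixes u :: "nat \<Rightarrow> 'a \<Rightarrow> complex"
  assumes [measurable]: "\<And>n. u n \<in> borel_measurable M" "U \<in> borel_measurable M"
    and w: "integrable M w"
    and bound: "\<And>N x. cmod (\<Sum>n<N. u n x) \<le> w x"
    and sums: "\<And>x. (\<lambda>n. u n x) sums U x"
  shows "(\<lambda>n. LINT x|M. u n x) sums (LINT x|M. U x)"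
proof -
  have part: "integrable M (\<lambda>x. \<Sum>n<N. u n x)" for N
  proof (rule Bochner_Integration.integrable_bound[OF w])
    show "AE x in M. norm (\<Sum>n<N. u n x) \<le> norm (w x)"
      using order_trans[OF bound abs_ge_self] by (intro AE_I2) simp
  qed simp
  have int: "integrable M (u n)" for n
    using Bochner_Integration.integrable_diff[OF part[of "Suc n"] part[of n]] by simp
  have "(\<lambda>N. LINT x|M. (\<Sum>n<N. u n x)) \<longlonglongrightarrow> (LINT x|M. U x)"
    by (rule integral_dominated_convergence[OF _ _ w])
       (use bound sums in \<open>auto simp: sums_def\<close>)
  then show ?thesis
    using int by (simp add: sums_def)
qed

section \<open>The Gaussian probability measure, and the Fock space inside its L2 space\<close>

definition gauss :: "complex measure" where
  "gauss = density lborel (\<lambda>z. ennreal (exp (- (cmod z)\<^sup>2) / pi))"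

lemma sets_gauss [simp, measurable_cong]: "sets gauss = sets borel"
  and space_gauss [simp]: "space gauss = UNIV"
  by (simp_all add: gauss_def)

lemma measurable_gauss_iff [simp]: "measurable gauss N = measurable borel N"
  by (rule measurable_cong_sets) auto

lemma prob_space_gauss: "prob_space gauss"
proof
  have "emeasure gauss (space gauss) = (\<integral>\<^sup>+z. ennreal (1 / pi) * ennreal (exp (- (cmod z)\<^sup>2)) \<partial>lborel)"
    by (simp add: gauss_def emeasure_density flip: ennreal_mult)
  also have "\<dots> = ennreal (1 / pi) * ennreal pi"
    by (subst nn_integral_cmult) (simp_all add: nn_integral_gaussian_complex)
  also have "\<dots> = 1"
    by (simp flip: ennreal_mult)
  finally show "emeasure gauss (space gauss) = 1" .
qed

interpretation gauss: prob_space gauss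
  by (rule prob_space_gauss)

lemma integrable_gauss_iff:
  fixes f :: "complex \<Rightarrow> 'b :: {banach, second_countable_topology}"
  assumes [measurable]: "f \<in> borel_measurable borel"
  shows "integrable gauss f \<longleftrightarrow> integrable lborel (\<lambda>z. exp (- (cmod z)\<^sup>2) *\<^sub>R f z)"
proof -
  have "integrable gauss f \<longleftrightarrow> integrable lborel (\<lambda>z. (1 / pi) *\<^sub>R (exp (- (cmod z)\<^sup>2) *\<^sub>R f z))"
    by (simp add: gauss_def integrable_density)
  then show ?thesis
    using integrable_scaleR_right[of pi lborel "\<lambda>z. (1 / pi) *\<^sub>R (exp (- (cmod z)\<^sup>2) *\<^sub>R f z)"]
      integrable_scaleR_right[of "1 / pi" lborel "\<lambda>z. exp (- (cmod z)\<^sup>2) *\<^sub>R f z"] by auto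
qed

lemma integral_gauss:
  fixes f :: "complex \<Rightarrow> 'b :: {banach, second_countable_topology}"
  assumes [measurable]: "f \<in> borel_measurable borel"
  shows "(LINT z|gauss. f z) = (1 / pi) *\<^sub>R (LINT z|lborel. exp (- (cmod z)\<^sup>2) *\<^sub>R f z)"
proof -
  have "(LINT z|gauss. f z) = (LINT z|lborel. (1 / pi) *\<^sub>R (exp (- (cmod z)\<^sup>2) *\<^sub>R f z))"
    by (simp add: gauss_def integral_density)
  then show ?thesis by (simp only: integral_scaleR_right)
qed

lemma entire_borel_measurable:
  assumes "f holomorphic_on UNIV"
  shows "f \<in> borel_measurable borel"
  using assms by (intro borel_measurable_continuous_onI holomorphic_on_imp_continuous_on)

lemma fock_space_iff:
  "f \<in> fock_space \<longleftrightarrow> f holomorphic_on UNIV \<and> integrable gauss (\<lambda>z. (cmod (f z))\<^sup>2)"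
proof -
  have "integrable gauss (\<lambda>z. (cmod (f z))\<^sup>2) \<longleftrightarrow>
      integrable lborel (\<lambda>z. (cmod (f z))\<^sup>2 * exp (- (cmod z)\<^sup>2))" if "f holomorphic_on UNIV"
    using entire_borel_measurable[OF that] by (subst integrable_gauss_iff) (auto simp: mult.commute)
  then show ?thesis by (auto simp: fock_space_def)
qed

lemma fock_spaceD:
  assumes "f \<in> fock_space"
  shows "f holomorphic_on UNIV" "f \<in> borel_measurable borel" "integrable gauss (\<lambda>z. (cmod (f z))\<^sup>2)"
  using assms entire_borel_measurable by (auto simp: fock_space_iff)

lemma fock_inner_eq:
  assumes [measurable]: "f \<in> borel_measurable borel" "g \<in> borel_measurable borel"
  shows "fock_inner f g = (LINT z|gauss. f z * cnj (g z))"
  unfolding fock_inner_def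
  by (subst integral_gauss) (simp_all add: scaleR_conv_of_real mult.commute)

lemma fock_norm_eq:
  assumes [measurable]: "f \<in> borel_measurable borel"
  shows "fock_norm f = sqrt (LINT z|gauss. (cmod (f z))\<^sup>2)"
proof -
  have "fock_inner f f = (LINT z|gauss. complex_of_real ((cmod (f z))\<^sup>2))"
    by (simp add: fock_inner_eq complex_norm_square del: of_real_power)
  then show ?thesis by (simp add: fock_norm_def del: of_real_power)
qed

lemma fock_norm_nonneg [simp]: "f \<in> fock_space \<Longrightarrow> 0 \<le> fock_norm f"
  by (simp add: fock_norm_eq fock_spaceD)

lemma fock_Cauchy_Schwarz:
  assumes "f \<in> fock_space" "g \<in> fock_space"
  shows "cmod (fock_inner f g) \<le> fock_norm f * fock_norm g"
  using L2_Cauchy_Schwarz[of f gauss g] fock_spaceD[OF assms(1)] fock_spaceD[OF assms(2)]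
  by (simp add: fock_inner_eq fock_norm_eq)

lemma fock_integrable_inner:
  assumes "f \<in> fock_space" "g \<in> fock_space"
  shows "integrable gauss (\<lambda>z. f z * cnj (g z))"
  using L2_mult_integrable[of f gauss g] fock_spaceD[OF assms(1)] fock_spaceD[OF assms(2)] by simp

lemma fock_space_0 [simp]: "(\<lambda>z. 0) \<in> fock_space"
  by (simp add: fock_space_iff)

lemma fock_space_cmult:
  "f \<in> fock_space \<Longrightarrow> (\<lambda>z. \<alpha> * f z) \<in> fock_space"
  by (simp add: fock_space_iff norm_mult power_mult_distrib holomorphic_on_mult)

lemma fock_space_diff:
  assumes "f \<in> fock_space" "g \<in> fock_space"
  shows "(\<lambda>z. f z - g z) \<in> fock_space"
  using L2_diff_integrable[of f gauss g] fock_spaceD[OF assms(1)] fock_spaceD[OF assms(2)]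
  by (simp add: fock_space_iff holomorphic_on_diff)

lemma fock_space_lincomb:
  assumes "f \<in> fock_space" "g \<in> fock_space"
  shows "(\<lambda>z. \<alpha> * f z + \<beta> * g z) \<in> fock_space"
  using fock_space_diff[OF fock_space_cmult[OF assms(1), of \<alpha>] fock_space_cmult[OF assms(2), of "-\<beta>"]]
  by simp

lemma fock_inner_diff_left:
  assumes "f \<in> fock_space" "g \<in> fock_space" "h \<in> fock_space"
  shows "fock_inner (\<lambda>z. f z - g z) h = fock_inner f h - fock_inner g h"
  using fock_integrable_inner[OF assms(1,3)] fock_integrable_inner[OF assms(2,3)]
    fock_spaceD(2)[OF assms(1)] fock_spaceD(2)[OF assms(2)] fock_spaceD(2)[OF assms(3)]
  by (simp add: fock_inner_eq left_diff_distrib)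

lemma fock_inner_commute:
  assumes "f \<in> fock_space" "g \<in> fock_space"
  shows "fock_inner f g = cnj (fock_inner g f)"
proof -
  have "cnj (fock_inner g f) = (LINT z|gauss. cnj (g z * cnj (f z)))"
    by (simp only: Bochner_Integration.integral_cnj fock_inner_eq[OF fock_spaceD(2)[OF assms(2)] fock_spaceD(2)[OF assms(1)]])
  also have "\<dots> = (LINT z|gauss. f z * cnj (g z))"
    by (rule Bochner_Integration.integral_cong) (simp_all add: mult.commute)
  finally show ?thesis
    using fock_spaceD(2)[OF assms(1)] fock_spaceD(2)[OF assms(2)] by (simp add: fock_inner_eq)
qed

lemma fock_inner_diff_right:
  assumes "f \<in> fock_space" "g \<in> fock_space" "h \<in> fock_space"
  shows "fock_inner h (\<lambda>z. f z - g z) = fock_inner h f - fock_inner h g"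
  using assms fock_inner_diff_left[OF assms]
  by (simp add: fock_inner_commute[of h] fock_space_diff)

section \<open>The reproducing kernel\<close>

lemma entire_compose:
  assumes "f holomorphic_on UNIV" "g holomorphic_on UNIV"
  shows "(\<lambda>z. f (g z)) holomorphic_on UNIV"
  using holomorphic_on_compose_gen[of g UNIV f UNIV] assms by (simp add: o_def)

lemma entire_taylor_sums:
  assumes "f holomorphic_on UNIV"
  shows "(\<lambda>n. (deriv ^^ n) f z / fact n * (w - z) ^ n) sums f w"
  by (rule holomorphic_power_series[of f z "dist z w + 1"])
     (use assms holomorphic_on_subset in auto)

text \<open>Cauchy's inequality on the circle of radius \<open>\<rho>\<close>. The product form
  covers \<open>\<rho> = 0\<close>, and the majorant is a function of the modulus because the radius
  will vary with the point.\<close>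

lemma entire_taylor_coeff_bound:
  assumes f: "f holomorphic_on UNIV" and "0 \<le> \<rho>"
    and bound: "\<And>u. cmod (f u) \<le> M (cmod u)"
  shows "cmod ((deriv ^^ n) f 0 / fact n) * \<rho> ^ n \<le> M \<rho>"
proof (cases "\<rho> = 0")
  case True
  have "0 \<le> M 0" using order_trans[OF norm_ge_zero bound[of 0]] by simp
  then show ?thesis
    using True bound[of 0] by (cases n) auto
next
  case False
  then have pos: "\<rho> > 0" using assms by simp
  have "cmod ((deriv ^^ n) f 0) \<le> fact n * M \<rho> / \<rho> ^ n"
  proof (rule Cauchy_inequality)
    show "f holomorphic_on ball 0 \<rho>" "continuous_on (cball 0 \<rho>) f"
      using f holomorphic_on_subset holomorphic_on_imp_continuous_on by blast+
    show "cmod (f x) \<le> M \<rho>" if "cmod (0 - x) = \<rho>" for x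
      using bound[of x] that by simp
  qed fact
  then show ?thesis
    using pos by (simp add: norm_divide field_simps)
qed

text \<open>The factor \<open>s^2\<close> is split: \<open>(s * cmod u) ^ n\<close> is paid by
  Cauchy's inequality at radius \<open>s * cmod u\<close>, and the remaining \<open>s ^ n\<close>
  sums to \<open>1 / (1 - s)\<close>. The bound is uniform in \<open>N\<close>, and a majorant
  \<open>exp (t^2 / 2)\<close> turns into \<open>exp (s^2 * t^2 / 2)\<close>, which is square
  integrable against the Gaussian.\<close>

lemma entire_taylor_partial_sum_bound:
  assumes f: "f holomorphic_on UNIV" and s: "0 \<le> s" "s < 1"
    and bound: "\<And>u. cmod (f u) \<le> M (cmod u)"
  shows "cmod (\<Sum>n<N. (deriv ^^ n) f 0 / fact n * (of_real (s\<^sup>2) * u) ^ n) \<le> M (s * cmod u) / (1 - s)"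
proof -
  have M: "0 \<le> M (s * cmod u)"
    using order_trans[OF norm_ge_zero bound[of "of_real s * u"]] s by (simp add: norm_mult)
  have "cmod (\<Sum>n<N. (deriv ^^ n) f 0 / fact n * (of_real (s\<^sup>2) * u) ^ n)
      \<le> (\<Sum>n<N. s ^ n * M (s * cmod u))"
  proof (rule sum_norm_le)
    fix n
    have "cmod ((deriv ^^ n) f 0 / fact n * (of_real (s\<^sup>2) * u) ^ n)
        = s ^ n * (cmod ((deriv ^^ n) f 0 / fact n) * (s * cmod u) ^ n)"
      using s by (simp add: norm_mult norm_power norm_divide power_mult_distrib power2_eq_square)
    also have "\<dots> \<le> s ^ n * M (s * cmod u)"
      using s by (intro mult_left_mono entire_taylor_coeff_bound f bound) auto
    finally show "cmod ((deriv ^^ n) f 0 / fact n * (of_real (s\<^sup>2) * u) ^ n) \<le> s ^ n * M (s * cmod u)" .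
  qed
  also have "\<dots> = (\<Sum>n<N. s ^ n) * M (s * cmod u)"
    by (simp add: sum_distrib_right)
  also have "\<dots> \<le> (1 / (1 - s)) * M (s * cmod u)"
  proof (rule mult_right_mono[OF _ M])
    have "(\<Sum>n<N. s ^ n) \<le> (\<Sum>n. s ^ n)"
      using s by (intro sum_le_suminf) auto
    then show "(\<Sum>n<N. s ^ n) \<le> 1 / (1 - s)"
      using s by (simp add: suminf_geometric)
  qed
  finally show ?thesis by simp
qed

section \<open>The mean value property for the Gaussian measure\<close>

lemma integral_gauss_rotate:
  fixes f :: "complex \<Rightarrow> complex"
  assumes "cmod a = 1" and [measurable]: "f \<in> borel_measurable borel"
  shows "(LINT z|gauss. f (a * z)) = (LINT z|gauss. f z)"
  using integral_lborel_preserving[OF lborel_preserving_rotate[OF assms(1)],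
      of "\<lambda>z. exp (- (cmod z)\<^sup>2) *\<^sub>R f z"] assms(1)
  by (simp add: integral_gauss norm_mult)

text \<open>Rotation by \<open>pi / n\<close> preserves the measure and the ball but changes the
  sign of \<open>z ^ n\<close>, so the integral equals its own negative.\<close>

lemma integral_gauss_monomial_ball:
  assumes "n > 0"
  shows "(LINT z|gauss. indicator (cball 0 R) z *\<^sub>R z ^ n) = (0 :: complex)"
proof -
  define a where "a = cis (pi / n)"
  have a: "cmod a = 1" "a ^ n = -1"
    using assms by (simp_all add: a_def Complex.DeMoivre)
  have "(LINT z|gauss. indicator (cball 0 R) z *\<^sub>R z ^ n)
      = (LINT z|gauss. indicator (cball 0 R) (a * z) *\<^sub>R (a * z) ^ n)"
    by (rule integral_gauss_rotate[symmetric])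
       (auto simp: a intro!: borel_measurable_scaleR borel_measurable_indicator)
  also have "\<dots> = (LINT z|gauss. - (indicator (cball 0 R) z *\<^sub>R z ^ n))"
    by (rule Bochner_Integration.integral_cong)
       (auto simp: a norm_mult power_mult_distrib indicator_def)
  finally show ?thesis by simp
qed

text \<open>On a ball the Taylor series has a constant majorant, so it may be integrated term by
  term, and only the constant term survives.\<close>

lemma gauss_mean_value_ball:
  assumes f: "f holomorphic_on UNIV" and "R \<ge> 0"
  shows "(LINT z|gauss. indicator (cball 0 R) z *\<^sub>R f z) = measure gauss (cball 0 R) *\<^sub>R f 0"
proof -
  have [measurable]: "f \<in> borel_measurable borel"
    by (rule entire_borel_measurable[OF f])
  define c where "c n = (deriv ^^ n) f 0 / fact n" for n
  have sums: "(\<lambda>n. c n * z ^ n) sums f z" for z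
    using entire_taylor_sums[OF f, of 0 z] by (simp add: c_def)
  \<comment> \<open>Convergence at the larger radius \<open>R + 1\<close> gives absolute convergence
    at \<open>R\<close>.\<close>
  have "summable (\<lambda>n. norm (c n * complex_of_real R ^ n))"
    by (rule powser_insidea[of c "complex_of_real (R + 1)"])
       (use sums_summable[OF sums] \<open>R \<ge> 0\<close> in auto)
  then have summ: "summable (\<lambda>n. norm (c n) * R ^ n)"
    using \<open>R \<ge> 0\<close> by (simp add: norm_mult norm_power)
  have "(\<lambda>n. LINT z|gauss. indicator (cball 0 R) z *\<^sub>R (c n * z ^ n)) sums
      (LINT z|gauss. indicator (cball 0 R) z *\<^sub>R f z)"
  proof (rule sums_integral_dominated[where w = "\<lambda>_. \<Sum>n. norm (c n) * R ^ n"])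
    fix N and z :: complex
    have "cmod (\<Sum>n<N. indicator (cball 0 R) z *\<^sub>R (c n * z ^ n)) \<le> (\<Sum>n<N. norm (c n) * R ^ n)"
      using \<open>R \<ge> 0\<close>
      by (intro sum_norm_le) (auto simp: indicator_def norm_mult norm_power
          intro!: mult_left_mono power_mono)
    also have "\<dots> \<le> (\<Sum>n. norm (c n) * R ^ n)"
      using summ \<open>R \<ge> 0\<close> by (intro sum_le_suminf) auto
    finally show "cmod (\<Sum>n<N. indicator (cball 0 R) z *\<^sub>R (c n * z ^ n)) \<le> (\<Sum>n. norm (c n) * R ^ n)" .
    show "(\<lambda>n. indicator (cball 0 R) z *\<^sub>R (c n * z ^ n)) sums (indicator (cball 0 R) z *\<^sub>R f z)"
      by (intro sums_scaleR_right sums)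
  qed (auto intro!: borel_measurable_scaleR borel_measurable_indicator)
  moreover have "(LINT z|gauss. indicator (cball 0 R) z *\<^sub>R (c n * z ^ n)) = (if n = 0 then measure gauss (cball 0 R) *\<^sub>R f 0 else 0)" for n
  proof (cases "n = 0")
    case True
    have "c 0 = f 0" by (simp add: c_def)
    moreover have "integrable gauss (indicat_real (cball 0 R))"
      by (rule integrable_real_indicator) (auto simp: gauss.emeasure_finite less_top[symmetric])
    ultimately show ?thesis using True by simp
  next
    case False
    have "(LINT z|gauss. indicator (cball 0 R) z *\<^sub>R (c n * z ^ n))
        = (LINT z|gauss. c n * (indicator (cball 0 R) z *\<^sub>R z ^ n))"
      by simp
    also have "\<dots> = c n * (LINT z|gauss. indicator (cball 0 R) z *\<^sub>R z ^ n)"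
      by (rule integral_mult_right_zero)
    finally show ?thesis
      using False integral_gauss_monomial_ball[of n R] by simp
  qed
  ultimately have "(\<lambda>n. if n = 0 then measure gauss (cball 0 R) *\<^sub>R f 0 else 0) sums
      (LINT z|gauss. indicator (cball 0 R) z *\<^sub>R f z)"
    by simp
  moreover have "(\<lambda>n. if n = 0 then measure gauss (cball 0 R) *\<^sub>R f 0 else 0) sums (measure gauss (cball 0 R) *\<^sub>R f 0)"
    using sums_single[of 0 "\<lambda>_. measure gauss (cball 0 R) *\<^sub>R f 0"] by simp
  ultimately show ?thesis using sums_unique2 by blast
qed

text \<open>On the whole plane integrability of \<open>f\<close> gives no majorant for its Taylor
  partial sums. The identity on balls is passed to the limit instead, dominated by
  \<open>cmod (f z)\<close> on one side and by 1 on the other.\<close>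

lemma gauss_mean_value:
  assumes f: "f holomorphic_on UNIV" and int: "integrable gauss f"
  shows "(LINT z|gauss. f z) = f 0"
proof -
  have [measurable]: "f \<in> borel_measurable borel"
    by (rule entire_borel_measurable[OF f])
  have ind: "(\<lambda>k. indicator (cball 0 (real k)) z) \<longlonglongrightarrow> (1 :: real)" for z :: complex
  proof (rule tendsto_eventually)
    obtain k0 where "cmod z \<le> real k0" using real_arch_simple by blast
    then show "\<forall>\<^sub>F k in sequentially. indicator (cball 0 (real k)) z = (1 :: real)"
      by (intro eventually_sequentiallyI[of k0]) (auto simp: indicator_def)
  qed
  have A: "(\<lambda>k. LINT z|gauss. indicator (cball 0 (real k)) z *\<^sub>R f z) \<longlonglongrightarrow> (LINT z|gauss. f z)"
  proof (rule integral_dominated_convergence[where w = "\<lambda>z. cmod (f z)"])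
    show "AE z in gauss. (\<lambda>k. indicator (cball 0 (real k)) z *\<^sub>R f z) \<longlonglongrightarrow> f z"
      using tendsto_scaleR[OF ind tendsto_const] by (intro AE_I2) simp
  qed (use int in \<open>auto simp: indicator_def\<close>)
  have B: "(\<lambda>k. LINT z|gauss. indicator (cball 0 (real k)) z :: real) \<longlonglongrightarrow> (LINT z|gauss. 1)"
  proof (rule integral_dominated_convergence[where w = "\<lambda>_. 1"])
  qed (use ind in \<open>auto simp: indicator_def\<close>)
  have "(\<lambda>k. measure gauss (cball 0 (real k)) *\<^sub>R f 0) \<longlonglongrightarrow> 1 *\<^sub>R f 0"
    using B by (intro tendsto_intros) (simp add: gauss.prob_space[simplified])
  with A show ?thesis
    using LIMSEQ_unique by (auto simp: gauss_mean_value_ball[OF f])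
qed

section \<open>Growth criteria and kernels\<close>

definition fock_kernel :: "complex \<Rightarrow> complex \<Rightarrow> complex" where
  "fock_kernel w = (\<lambda>z. exp (cnj w * z))"

lemma integrable_gauss_exp:
  fixes \<beta> k :: real
  assumes "\<beta> < 1"
  shows "integrable gauss (\<lambda>z. exp (\<beta> * (cmod z)\<^sup>2 + k * cmod z))"
proof -
  \<comment> \<open>Half of the spare decay \<open>1 - \<beta>\<close> absorbs the linear term by
    completing the square; the other half keeps the majorant integrable.\<close>
  define e where "e = (1 - \<beta>) / 2"
  have e: "e > 0" using assms by (simp add: e_def)
  have "integrable lborel (\<lambda>z. exp (- (cmod z)\<^sup>2))"
    by (rule integrableI_nonneg) (simp_all add: nn_integral_gaussian_complex)
  from integrable_lborel_scale(1)[OF _ this, of "sqrt e" 0]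
  have int: "integrable lborel (\<lambda>z. exp (- e * (cmod z)\<^sup>2))"
    using e by (simp add: norm_mult power_mult_distrib)
  have "integrable lborel (\<lambda>z. exp (- (cmod z)\<^sup>2) *\<^sub>R exp (\<beta> * (cmod z)\<^sup>2 + k * cmod z))"
  proof (rule Bochner_Integration.integrable_bound)
    show "integrable lborel (\<lambda>z. exp (k\<^sup>2 / (4 * e)) * exp (- e * (cmod z)\<^sup>2))"
      using int by simp
    have "exp (- t\<^sup>2) * exp (\<beta> * t\<^sup>2 + k * t) \<le> exp (k\<^sup>2 / (4 * e)) * exp (- e * t\<^sup>2)" for t :: real
    proof -
      have "0 \<le> (2 * e * t - k)\<^sup>2 / (4 * e)" using e by simp
      also have "\<dots> = e * t\<^sup>2 - k * t + k\<^sup>2 / (4 * e)"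
        using e by (simp add: power2_eq_square field_simps)
      finally have "- t\<^sup>2 + (\<beta> * t\<^sup>2 + k * t) \<le> k\<^sup>2 / (4 * e) + - e * t\<^sup>2"
        by (simp add: e_def field_simps)
      then show ?thesis
        unfolding exp_add[symmetric] by simp
    qed
    then show "AE z in lborel. norm (exp (- (cmod z)\<^sup>2) *\<^sub>R exp (\<beta> * (cmod z)\<^sup>2 + k * cmod z))
        \<le> norm (exp (k\<^sup>2 / (4 * e)) * exp (- e * (cmod z)\<^sup>2))"
      by (intro AE_I2) (simp add: abs_mult)
  qed simp
  then show ?thesis by (simp add: integrable_gauss_iff)
qed

lemma integrable_gauss_exp_square:
  fixes \<beta> k M :: real
  assumes "\<beta> < 1 / 2"
  shows "integrable gauss (\<lambda>z. (M * exp (\<beta> * (cmod z)\<^sup>2 + k * cmod z))\<^sup>2)"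
proof -
  have "(M * exp (\<beta> * (cmod z)\<^sup>2 + k * cmod z))\<^sup>2 = M\<^sup>2 * exp ((2 * \<beta>) * (cmod z)\<^sup>2 + (2 * k) * cmod z)" for z
    by (simp add: power_mult_distrib exp_double[symmetric] algebra_simps)
  then show ?thesis
    using integrable_gauss_exp[of "2 * \<beta>" "2 * k"] assms by simp
qed

text \<open>Squaring doubles the exponent, hence the threshold \<open>1 / 2\<close>. That value is
  just excluded, and it is the one that \<open>fock_pointwise_bound\<close> gives for a general Fock
  function; dilates fall below it.\<close>

lemma fock_space_growthI:
  fixes \<beta> k M :: real
  assumes f: "f holomorphic_on UNIV" and "\<beta> < 1 / 2"
    and bound: "\<And>z. cmod (f z) \<le> M * exp (\<beta> * (cmod z)\<^sup>2 + k * cmod z)"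
  shows "f \<in> fock_space"
  unfolding fock_space_iff
proof (intro conjI f Bochner_Integration.integrable_bound[OF integrable_gauss_exp_square[OF assms(2), of M k]])
  show "(\<lambda>z. (cmod (f z))\<^sup>2) \<in> borel_measurable gauss"
    using entire_borel_measurable[OF f] by simp
  show "AE z in gauss. norm ((cmod (f z))\<^sup>2) \<le> norm ((M * exp (\<beta> * (cmod z)\<^sup>2 + k * cmod z))\<^sup>2)"
    using power_mono[OF bound norm_ge_zero, of _ 2] by (intro AE_I2) simp
qed

lemma integrable_gauss_growth_mult_fock:
  fixes \<beta> k M :: real
  assumes g: "g \<in> fock_space" and "\<beta> < 1 / 2"
  shows "integrable gauss (\<lambda>z. M * exp (\<beta> * (cmod z)\<^sup>2 + k * cmod z) * cmod (g z))"
proof -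
  have "integrable gauss (\<lambda>z. complex_of_real (exp (\<beta> * (cmod z)\<^sup>2 + k * cmod z)) * cnj (g z))"
    using integrable_gauss_exp_square[OF assms(2), of 1 k] fock_spaceD[OF g]
    by (intro L2_mult_integrable) auto
  from integrable_norm[OF this] show ?thesis
    by (simp add: norm_mult mult.assoc)
qed

lemma fock_kernel_holomorphic [simp]: "fock_kernel w holomorphic_on A"
  unfolding fock_kernel_def by (intro holomorphic_intros)

lemma fock_kernel_in_fock_space [simp]: "fock_kernel w \<in> fock_space"
proof (rule fock_space_growthI[where M = 1 and \<beta> = 0 and k = "cmod w"])
  show "cmod (fock_kernel w z) \<le> 1 * exp (0 * (cmod z)\<^sup>2 + cmod w * cmod z)" for z
    using norm_exp[of "cnj w * z"] by (simp add: fock_kernel_def norm_mult)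
qed simp_all

text \<open>Translating by \<open>w\<close> turns the Gaussian times the conjugated kernel into the
  Gaussian times the entire function \<open>exp (- (cnj w * z))\<close>. The mean value property
  then evaluates \<open>h\<close> at 0, which is \<open>f w\<close>.\<close>

lemma fock_reproducing:
  assumes "f \<in> fock_space"
  shows "fock_inner f (fock_kernel w) = f w"
proof -
  note [measurable] = fock_spaceD(2)[OF assms] fock_spaceD(2)[OF fock_kernel_in_fock_space]
  define h where "h z = f (z + w) * exp (- (cnj w * z))" for z
  have "(\<lambda>z. f (z + w)) holomorphic_on UNIV"
    by (intro entire_compose[OF fock_spaceD(1)[OF assms]] holomorphic_intros)
  then have hol: "h holomorphic_on UNIV"
    unfolding h_def by (intro holomorphic_intros)
  then have [measurable]: "h \<in> borel_measurable borel" by (rule entire_borel_measurable)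
  define F where "F u = exp (- (cmod u)\<^sup>2) *\<^sub>R (f u * cnj (fock_kernel w u))" for u
  have [measurable]: "F \<in> borel_measurable borel" unfolding F_def by measurable
  have shift: "F (z + w) = exp (- (cmod z)\<^sup>2) *\<^sub>R h z" for z
  proof -
    have "complex_of_real (- (cmod (z + w))\<^sup>2) + w * cnj (z + w) = complex_of_real (- (cmod z)\<^sup>2) - cnj w * z"
      by (simp only: of_real_minus complex_norm_square) (simp add: algebra_simps)
    then have "exp (complex_of_real (- (cmod (z + w))\<^sup>2)) * exp (w * cnj (z + w))
        = exp (complex_of_real (- (cmod z)\<^sup>2)) * exp (- (cnj w * z))"
      unfolding exp_add[symmetric] by simp
    then show ?thesis
      by (simp add: F_def h_def fock_kernel_def scaleR_conv_of_real exp_of_real[symmetric] exp_cnj mult.left_commute del: of_real_minus of_real_power)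
  qed
  have "integrable lborel F"
    using fock_integrable_inner[OF assms fock_kernel_in_fock_space, of w]
    by (simp add: integrable_gauss_iff F_def[abs_def])
  then have "integrable lborel (\<lambda>z. F (z + w))"
    by (subst integrable_lborel_preserving_iff[OF lborel_preserving_translate]) auto
  then have int: "integrable gauss h"
    by (simp add: integrable_gauss_iff shift)
  have "fock_inner f (fock_kernel w) = (1 / pi) *\<^sub>R (LINT z|lborel. F z)"
    by (simp add: fock_inner_eq integral_gauss F_def)
  also have "\<dots> = (1 / pi) *\<^sub>R (LINT z|lborel. F (z + w))"
    by (subst integral_lborel_preserving[OF lborel_preserving_translate]) auto
  also have "\<dots> = (LINT z|gauss. h z)"
    by (simp add: integral_gauss shift)
  also have "\<dots> = f w"
    using gauss_mean_value[OF hol int] by (simp add: h_def)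
  finally show ?thesis .
qed

lemma fock_norm_kernel: "fock_norm (fock_kernel w) = exp ((cmod w)\<^sup>2 / 2)"
proof -
  have "fock_inner (fock_kernel w) (fock_kernel w) = exp (cnj w * w)"
    by (simp add: fock_reproducing) (simp add: fock_kernel_def)
  also have "\<dots> = of_real (exp ((cmod w)\<^sup>2))"
    by (simp add: complex_norm_square mult.commute del: of_real_power flip: exp_of_real)
  finally have "fock_norm (fock_kernel w) = sqrt (exp ((cmod w)\<^sup>2))"
    by (simp add: fock_norm_def)
  also have "exp ((cmod w)\<^sup>2) = (exp ((cmod w)\<^sup>2 / 2))\<^sup>2"
    by (simp flip: exp_double)
  finally show ?thesis by simp
qed

lemma fock_pointwise_bound:
  assumes "f \<in> fock_space"
  shows "cmod (f z) \<le> fock_norm f * exp ((cmod z)\<^sup>2 / 2)"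
  using fock_Cauchy_Schwarz[OF assms fock_kernel_in_fock_space, of z]
  by (simp add: fock_reproducing[OF assms] fock_norm_kernel)

section \<open>Adjoints and weighted composition conjugations\<close>

lemma fock_norm_power2:
  assumes "f \<in> fock_space"
  shows "(fock_norm f)\<^sup>2 = Re (fock_inner f f)"
proof -
  have "sqrt (Re (fock_inner f f)) \<ge> 0"
    using fock_norm_nonneg[OF assms] by (simp add: fock_norm_def)
  then show ?thesis by (simp add: fock_norm_def)
qed

lemma fock_tendsto_pointwise:
  assumes "\<And>n. X n \<in> fock_space" "f \<in> fock_space" "fock_tendsto X f"
  shows "(\<lambda>n. X n z) \<longlonglongrightarrow> f z"
proof (rule LIM_zero_cancel, rule Lim_null_comparison)
  show "\<forall>\<^sub>F n in sequentially. cmod (X n z - f z) \<le> fock_norm (\<lambda>z. X n z - f z) * exp ((cmod z)\<^sup>2 / 2)"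
    using fock_pointwise_bound[OF fock_space_diff[OF assms(1,2)]] by (intro always_eventually) simp
  show "(\<lambda>n. fock_norm (\<lambda>z. X n z - f z) * exp ((cmod z)\<^sup>2 / 2)) \<longlonglongrightarrow> 0"
    using assms(3) unfolding fock_tendsto_def by (rule tendsto_mult_left_zero)
qed

lemma orthogonal_to_dense_domain:
  assumes "densely_defined T" and u: "u \<in> fock_space"
    and orth: "\<And>f. f \<in> op_dom T \<Longrightarrow> fock_inner f u = 0"
  shows "u = (\<lambda>z. 0)"
proof -
  have "fock_norm u = 0"
  proof (rule ccontr)
    assume "fock_norm u \<noteq> 0"
    then have pos: "fock_norm u > 0" using fock_norm_nonneg[OF u] by simp
    then obtain g where g: "g \<in> op_dom T" and small: "fock_norm (\<lambda>z. u z - g z) < fock_norm u"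
      using assms(1) u unfolding densely_defined_def by blast
    have gF: "g \<in> fock_space" using assms(1) g by (auto simp: densely_defined_def)
    have "(fock_norm u)\<^sup>2 = Re (fock_inner (\<lambda>z. u z - g z) u)"
      using fock_inner_diff_left[OF u gF u] orth[OF g] fock_norm_power2[OF u] by simp
    also have "\<dots> \<le> fock_norm (\<lambda>z. u z - g z) * fock_norm u"
      using fock_Cauchy_Schwarz[OF fock_space_diff[OF u gF] u] complex_Re_le_cmod order_trans by blast
    also have "\<dots> < fock_norm u * fock_norm u"
      using small pos by simp
    finally show False by (simp add: power2_eq_square)
  qed
  then show ?thesis
    using fock_pointwise_bound[OF u] by (auto simp: fun_eq_iff)
qed

text \<open>Density makes the representing function unique, so the description in
  \<open>adjoint_op\<close> returns whatever \<open>h\<close> has been exhibited.\<close>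

lemma adjoint_op_app:
  assumes dense: "densely_defined T" and ran: "op_app T ` op_dom T \<subseteq> fock_space"
    and g: "g \<in> fock_space" and h: "h \<in> fock_space"
    and adj: "\<And>f. f \<in> op_dom T \<Longrightarrow> fock_inner (op_app T f) g = fock_inner f h"
  shows "g \<in> op_dom (adjoint_op T)" "op_app (adjoint_op T) g = h"
proof -
  show "g \<in> op_dom (adjoint_op T)"
    using g h adj by (auto simp: adjoint_op_def)
  have "(THE h. h \<in> fock_space \<and> (\<forall>f\<in>op_dom T. fock_inner (op_app T f) g = fock_inner f h)) = h"
  proof (rule the_equality)
    fix h' assume h': "h' \<in> fock_space \<and> (\<forall>f\<in>op_dom T. fock_inner (op_app T f) g = fock_inner f h')"
    have "(\<lambda>z. h' z - h z) = (\<lambda>z. 0)"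
    proof (rule orthogonal_to_dense_domain[OF dense])
      show "(\<lambda>z. h' z - h z) \<in> fock_space" using h h' fock_space_diff by blast
      fix f assume f: "f \<in> op_dom T"
      then have "f \<in> fock_space" using dense by (auto simp: densely_defined_def)
      then show "fock_inner f (\<lambda>z. h' z - h z) = 0"
        using fock_inner_diff_right[of h' h f] h h' adj[OF f] f by simp
    qed
    then show "h' = h" by (auto simp: fun_eq_iff)
  qed (use h adj in auto)
  then show "op_app (adjoint_op T) g = h" by (simp add: adjoint_op_def)
qed

lemma adjoint_op_domE:
  assumes "densely_defined T" "op_app T ` op_dom T \<subseteq> fock_space" "g \<in> op_dom (adjoint_op T)"
  obtains "g \<in> fock_space" "op_app (adjoint_op T) g \<in> fock_space"
    "\<And>f. f \<in> op_dom T \<Longrightarrow> fock_inner (op_app T f) g = fock_inner f (op_app (adjoint_op T) g)"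
proof -
  obtain h where "g \<in> fock_space" "h \<in> fock_space"
      "\<And>f. f \<in> op_dom T \<Longrightarrow> fock_inner (op_app T f) g = fock_inner f h"
    using assms(3) by (auto simp: adjoint_op_def)
  with adjoint_op_app(2)[OF assms(1,2) this] that show thesis by auto
qed

section \<open>Maximal weighted composition operators\<close>

lemma W_max_simps [simp]:
  "f \<in> op_dom (W_max \<psi> \<phi>) \<longleftrightarrow> f \<in> fock_space \<and> weighted_comp \<psi> \<phi> f \<in> fock_space"
  "op_app (W_max \<psi> \<phi>) f = weighted_comp \<psi> \<phi> f"
  by (simp_all add: W_max_def)

lemma W_max_range: "op_app (W_max \<psi> \<phi>) ` op_dom (W_max \<psi> \<phi>) \<subseteq> fock_space"
  by auto

lemma weighted_comp_lincomb:
  "weighted_comp \<psi> \<phi> (\<lambda>z. \<alpha> * f z + \<beta> * g z) =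
     (\<lambda>z. \<alpha> * weighted_comp \<psi> \<phi> f z + \<beta> * weighted_comp \<psi> \<phi> g z)"
  by (simp add: weighted_comp_def fun_eq_iff algebra_simps)

lemma W_max_dom_lincomb:
  assumes "f \<in> op_dom (W_max \<psi> \<phi>)" "g \<in> op_dom (W_max \<psi> \<phi>)"
  shows "(\<lambda>z. \<alpha> * f z + \<beta> * g z) \<in> op_dom (W_max \<psi> \<phi>)"
  using assms by (simp add: weighted_comp_lincomb fock_space_lincomb)

lemma linear_op_W_max: "linear_op (W_max \<psi> \<phi>)"
proof -
  have "weighted_comp \<psi> \<phi> (\<lambda>z. 0) = (\<lambda>z. 0)"
    by (simp add: weighted_comp_def)
  then show ?thesis
    using fock_space_lincomb by (auto simp: linear_op_def weighted_comp_lincomb)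
qed

text \<open>Norm convergence implies pointwise convergence, so \<open>g\<close> must be
  \<open>weighted_comp \<psi> \<phi> f\<close>. As \<open>g\<close> lies in the Fock space,
  \<open>f\<close> then lies in the domain by maximality.\<close>

lemma closed_op_W_max: "closed_op (W_max \<psi> \<phi>)"
  unfolding closed_op_def
proof (intro allI ballI impI)
  fix X f g
  assume f: "f \<in> fock_space" and g: "g \<in> fock_space"
    and X: "(\<forall>n. X n \<in> op_dom (W_max \<psi> \<phi>)) \<and> fock_tendsto X f \<and>
      fock_tendsto (\<lambda>n. op_app (W_max \<psi> \<phi>) (X n)) g"
  have "weighted_comp \<psi> \<phi> f z = g z" for z
  proof (rule LIMSEQ_unique)
    show "(\<lambda>n. weighted_comp \<psi> \<phi> (X n) z) \<longlonglongrightarrow> weighted_comp \<psi> \<phi> f z"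
      unfolding weighted_comp_def using X f
      by (intro tendsto_mult tendsto_const fock_tendsto_pointwise) auto
    show "(\<lambda>n. weighted_comp \<psi> \<phi> (X n) z) \<longlonglongrightarrow> g z"
      using X g by (intro fock_tendsto_pointwise) auto
  qed
  then have "weighted_comp \<psi> \<phi> f = g" by auto
  then show "f \<in> op_dom (W_max \<psi> \<phi>) \<and> op_app (W_max \<psi> \<phi>) f = g"
    using f g by simp
qed

lemma fock_inner_scaled_kernel:
  assumes "f \<in> fock_space"
  shows "fock_inner f (\<lambda>z. \<alpha> * fock_kernel w z) = cnj \<alpha> * f w"
proof -
  note [measurable] = fock_spaceD(2)[OF assms] fock_spaceD(2)[OF fock_kernel_in_fock_space]
  have "fock_inner f (\<lambda>z. \<alpha> * fock_kernel w z) = (LINT z|gauss. cnj \<alpha> * (f z * cnj (fock_kernel w z)))"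
    by (simp add: fock_inner_eq mult_ac)
  also have "\<dots> = cnj \<alpha> * (LINT z|gauss. f z * cnj (fock_kernel w z))"
    by (rule integral_mult_right_zero)
  also have "\<dots> = cnj \<alpha> * f w"
    using fock_reproducing[OF assms, of w] by (simp add: fock_inner_eq)
  finally show ?thesis .
qed

text \<open>Evaluating \<open>\<psi> z * f (\<phi> z)\<close> at \<open>w\<close> is
  \<open>\<psi> w\<close> times evaluation of \<open>f\<close> at \<open>\<phi> w\<close>. Both
  evaluations are inner products with kernels.\<close>

lemma adjoint_W_max_kernel:
  assumes "densely_defined (W_max \<psi> \<phi>)"
  shows "fock_kernel w \<in> op_dom (adjoint_op (W_max \<psi> \<phi>))"
    and "op_app (adjoint_op (W_max \<psi> \<phi>)) (fock_kernel w) = (\<lambda>z. cnj (\<psi> w) * fock_kernel (\<phi> w) z)"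
proof -
  have "fock_inner (op_app (W_max \<psi> \<phi>) f) (fock_kernel w) =
      fock_inner f (\<lambda>z. cnj (\<psi> w) * fock_kernel (\<phi> w) z)" if "f \<in> op_dom (W_max \<psi> \<phi>)" for f
    using that by (simp add: fock_reproducing fock_inner_scaled_kernel) (simp add: weighted_comp_def)
  note * = adjoint_op_app[OF assms W_max_range fock_kernel_in_fock_space _ this]
  show "fock_kernel w \<in> op_dom (adjoint_op (W_max \<psi> \<phi>))"
    and "op_app (adjoint_op (W_max \<psi> \<phi>)) (fock_kernel w) = (\<lambda>z. cnj (\<psi> w) * fock_kernel (\<phi> w) z)"
    by (rule *; simp add: fock_space_cmult)+
qed

section \<open>Weighted composition conjugations and the necessity of the symbols\<close>

locale fock_conjugation =
  fixes a b c :: complex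
  assumes norm_a: "cmod a = 1"
    and ab: "cnj a * b + cnj b = 0"
    and cb: "(cmod c)\<^sup>2 * exp ((cmod b)\<^sup>2) = 1"
begin

lemma cnj_a_a [simp]: "cnj a * a = 1" "a * cnj a = 1"
  using norm_a complex_norm_square[of a] by (simp_all add: mult.commute[of "cnj a"])

lemma b_eq: "b = - (a * cnj b)"
proof -
  have "a * (cnj a * b + cnj b) = (a * cnj a) * b + a * cnj b"
    by (simp only: distrib_left mult.assoc)
  then show ?thesis using ab by (simp add: eq_neg_iff_add_eq_0)
qed

lemma c_eq: "c * cnj c * exp (b * cnj b) = 1"
proof -
  have "c * cnj c * exp (b * cnj b) = of_real ((cmod c)\<^sup>2 * exp ((cmod b)\<^sup>2))"
    by (simp add: complex_norm_square del: of_real_power flip: exp_of_real)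
  then show ?thesis by (simp only: cb of_real_1)
qed

text \<open>\<open>ab\<close> makes \<open>z -> cnj (a * z + b)\<close> an involution of the plane.
  The two exponential weights multiply to the constant \<open>exp (b * cnj b)\<close>, which
  \<open>cb\<close> cancels against \<open>c * cnj c\<close>.\<close>

lemma wc_conj_involutive: "wc_conj a b c (wc_conj a b c f) = f"
proof
  fix z
  have 1: "cnj (a * cnj (a * z + b) + b) = z"
  proof -
    have "cnj (a * cnj (a * z + b) + b) = (cnj a * a) * z + (cnj a * b + cnj b)"
      by (simp add: algebra_simps del: cnj_a_a)
    then show ?thesis using ab by simp
  qed
  have 2: "b * z + cnj b * (a * z + b) = b * cnj b"
    by (subst (1) b_eq) (simp add: algebra_simps)
  have "wc_conj a b c (wc_conj a b c f) z = c * cnj c * exp (b * z + cnj b * (a * z + b)) * f (cnj (a * cnj (a * z + b) + b))"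
    by (simp add: wc_conj_def exp_cnj exp_add mult_ac del: complex_cnj_add)
  also have "\<dots> = f z"
    unfolding 1 2 using c_eq by simp
  finally show "wc_conj a b c (wc_conj a b c f) z = f z" .
qed

text \<open>Since \<open>a * cnj b = - b\<close>, one has
  \<open>|a z + b|^2 = |z|^2 + |b|^2 - 2 Re (b z)\<close>. Hence \<open>|exp (b z)|^2\<close> is
  exactly the change of the Gaussian under the measure-preserving map
  \<open>z -> cnj (a * z + b)\<close>, up to the constant normalised by \<open>cb\<close>.\<close>

lemma wc_conj_fock_space:
  assumes "f \<in> fock_space"
  shows "wc_conj a b c f \<in> fock_space"
proof -
  have "cnj \<circ> f \<circ> cnj holomorphic_on UNIV"
    using fock_spaceD(1)[OF assms] by (intro holomorphic_on_compose_cnj_cnj) (auto intro: holomorphic_on_subset)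
  then have "(\<lambda>z. (cnj \<circ> f \<circ> cnj) (a * z + b)) holomorphic_on UNIV"
    by (rule entire_compose) (intro holomorphic_intros)
  then have "wc_conj a b c f holomorphic_on UNIV"
    unfolding wc_conj_def by (intro holomorphic_intros) (simp_all add: o_def)
  moreover have "integrable lborel (\<lambda>z. (cmod (wc_conj a b c f z))\<^sup>2 * exp (- (cmod z)\<^sup>2))"
  proof -
    define F where "F u = (cmod (f u))\<^sup>2 * exp (- (cmod u)\<^sup>2)" for u
    have "lborel_preserving (\<lambda>z. cnj (a * z + b))"
      using lborel_preserving_compose[OF lborel_preserving_cnj
          lborel_preserving_compose[OF lborel_preserving_translate[of b] lborel_preserving_rotate[OF norm_a]]] .
    moreover have "integrable lborel F"
      using assms by (simp add: fock_space_def F_def[abs_def])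
    moreover have "F \<in> borel_measurable borel"
      using \<open>integrable lborel F\<close> by auto
    ultimately have "integrable lborel (\<lambda>z. F (cnj (a * z + b)))"
      using integrable_lborel_preserving_iff by blast
    moreover have "F (cnj (a * z + b)) = (cmod (wc_conj a b c f z))\<^sup>2 * exp (- (cmod z)\<^sup>2)" for z
    proof -
      have "complex_of_real ((cmod (a * z + b))\<^sup>2) = (a * z + b) * cnj (a * z + b)"
        by (simp only: complex_norm_square)
      also have "\<dots> = (a * cnj a) * (z * cnj z) + b * cnj b + ((a * cnj b) * z + cnj ((a * cnj b) * z))"
        by (simp add: algebra_simps del: cnj_a_a)
      also have "a * cnj b = - b" using b_eq by (metis minus_minus)
      also have "(a * cnj a) * (z * cnj z) + b * cnj b + (- b * z + cnj (- b * z)) =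
          complex_of_real ((cmod z)\<^sup>2 + (cmod b)\<^sup>2 - 2 * Re (b * z))"
        using complex_add_cnj[of "b * z"] by (simp add: complex_norm_square algebra_simps del: of_real_power)
      finally have *: "(cmod (a * z + b))\<^sup>2 = (cmod z)\<^sup>2 + (cmod b)\<^sup>2 - 2 * Re (b * z)"
        by (simp only: of_real_eq_iff)
      have "(cmod (wc_conj a b c f z))\<^sup>2 * exp (- (cmod z)\<^sup>2)
          = (cmod c)\<^sup>2 * (cmod (f (cnj (a * z + b))))\<^sup>2 * (exp (2 * Re (b * z)) * exp (- (cmod z)\<^sup>2))"
        by (simp only: wc_conj_def norm_mult power_mult_distrib exp_double norm_exp_eq_Re complex_mod_cnj mult_ac)
      also have "exp (2 * Re (b * z)) * exp (- (cmod z)\<^sup>2) = exp ((cmod b)\<^sup>2) * exp (- (cmod (a * z + b))\<^sup>2)"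
        unfolding exp_add[symmetric] * by simp
      finally have "(cmod (wc_conj a b c f z))\<^sup>2 * exp (- (cmod z)\<^sup>2)
          = ((cmod c)\<^sup>2 * exp ((cmod b)\<^sup>2)) * ((cmod (f (cnj (a * z + b))))\<^sup>2 * exp (- (cmod (a * z + b))\<^sup>2))"
        by (simp only: mult_ac)
      then show ?thesis
        unfolding cb F_def by (simp only: complex_mod_cnj mult_1)
    qed
    ultimately show ?thesis by simp
  qed
  ultimately show ?thesis by (simp add: fock_space_def)
qed

lemma wc_conj_fock_space_iff: "wc_conj a b c f \<in> fock_space \<longleftrightarrow> f \<in> fock_space"
  using wc_conj_fock_space wc_conj_involutive by metis

text \<open>As the conjugation \<open>J\<close> is an involution, \<open>T = J T* J\<close> can be
  solved for \<open>T*\<close>, giving \<open>T* = J T J\<close>; the extension is one half of this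
  equality.\<close>

lemma conj_selfadjoint_imp_adjoint_extends:
  assumes "conj_selfadjoint (wc_conj a b c) (W_max \<psi> \<phi>)"
  shows "adjoint_op (W_max \<psi> \<phi>) \<preceq>\<^sub>o\<^sub>p sandwich_op (wc_conj a b c) (W_max \<psi> \<phi>) (wc_conj a b c)"
proof -
  let ?J = "wc_conj a b c" and ?T = "W_max \<psi> \<phi>"
  have eq: "op_eq ?T (sandwich_op ?J (adjoint_op ?T) ?J)"
    using assms by (simp add: conj_selfadjoint_def)
  have "?J g \<in> op_dom ?T \<and> ?J (op_app ?T (?J g)) = op_app (adjoint_op ?T) g"
    if g: "g \<in> op_dom (adjoint_op ?T)" for g
  proof -
    have "g \<in> fock_space" using g by (auto simp: adjoint_op_def)
    then have "?J g \<in> op_dom (sandwich_op ?J (adjoint_op ?T) ?J)"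
      using g by (simp add: sandwich_op_def wc_conj_involutive wc_conj_fock_space)
    then have "?J g \<in> op_dom ?T" "op_app ?T (?J g) = ?J (op_app (adjoint_op ?T) g)"
      using eq unfolding op_eq_def by (auto simp: sandwich_op_def wc_conj_involutive)
    then show ?thesis by (simp add: wc_conj_involutive)
  qed
  then show ?thesis
    by (auto simp: op_extends_def sandwich_op_def adjoint_op_def)
qed

lemma wc_conj_kernel: "wc_conj a b c (fock_kernel w) z = c * exp (b * z + (a * z + b) * w)"
  by (simp add: wc_conj_def fock_kernel_def exp_cnj exp_add mult_ac)

lemma adjoint_extends_imp_symbols:
  assumes hol: "\<psi> holomorphic_on UNIV" "\<phi> holomorphic_on UNIV" and nz: "\<exists>z. \<psi> z \<noteq> 0"
    and dense: "densely_defined (W_max \<psi> \<phi>)"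
    and ext: "adjoint_op (W_max \<psi> \<phi>) \<preceq>\<^sub>o\<^sub>p sandwich_op (wc_conj a b c) (W_max \<psi> \<phi>) (wc_conj a b c)"
  shows "\<exists>A B C D. C \<noteq> 0 \<and> D = a * B - b * A + b \<and> (\<forall>z. \<phi> z = A * z + B) \<and> (\<forall>z. \<psi> z = C * exp (D * z))"
proof -
  have c: "c \<noteq> 0" using cb by auto
  have a: "a \<noteq> 0" using norm_a by auto
  \<comment> \<open>This is \<open>T* K = J T J K\<close> for the kernel \<open>K\<close> at
    \<open>z\<close>, with \<open>J\<close> applied to both sides and the result evaluated at
    \<open>u\<close>; the common factor \<open>c\<close> cancels.\<close>
  have fe: "\<psi> u * exp (b * \<phi> u + (a * \<phi> u + b) * z) = \<psi> z * exp (b * u + (a * u + b) * \<phi> z)" for u z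
  proof -
    have "wc_conj a b c (weighted_comp \<psi> \<phi> (wc_conj a b c (fock_kernel z))) = (\<lambda>v. cnj (\<psi> z) * fock_kernel (\<phi> z) v)"
      using ext adjoint_W_max_kernel[OF dense, of z] unfolding op_extends_def
      by (auto simp: sandwich_op_def)
    then have "weighted_comp \<psi> \<phi> (wc_conj a b c (fock_kernel z)) = wc_conj a b c (\<lambda>v. cnj (\<psi> z) * fock_kernel (\<phi> z) v)"
      by (metis wc_conj_involutive)
    then have "weighted_comp \<psi> \<phi> (wc_conj a b c (fock_kernel z)) u = wc_conj a b c (\<lambda>v. cnj (\<psi> z) * fock_kernel (\<phi> z) v) u"
      by (rule fun_cong)
    also have "\<dots> = \<psi> z * wc_conj a b c (fock_kernel (\<phi> z)) u"
      by (simp add: wc_conj_def)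
    finally show ?thesis
      using c by (simp add: weighted_comp_def wc_conj_kernel)
  qed
  define B where "B = \<phi> 0"
  define A where "A = deriv \<phi> 0"
  \<comment> \<open>Putting \<open>z = 0\<close> in \<open>fe\<close> expresses
    \<open>\<psi>\<close> through \<open>\<phi>\<close> and the value \<open>\<psi> 0\<close>, which
    therefore cannot vanish.\<close>
  have psi: "\<psi> u = \<psi> 0 * exp (b * u + (a * u + b) * B - b * \<phi> u)" for u
    using fe[of u 0] by (simp add: B_def exp_diff field_simps)
  have psi0: "\<psi> 0 \<noteq> 0" using nz psi by (metis mult_zero_left)
  \<comment> \<open>Eliminating \<open>\<psi>\<close> leaves an exponential identity in \<open>z\<close>, whose derivative at 0 determines \<open>\<phi>\<close>.\<close>
  have one: "exp (a * (z * (\<phi> u - B) - u * (\<phi> z - B))) = 1" for u z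
  proof -
    have "\<psi> 0 * exp (b * u + (a * u + b) * B - b * \<phi> u) * exp (b * \<phi> u + (a * \<phi> u + b) * z)
        = \<psi> 0 * exp (b * z + (a * z + b) * B - b * \<phi> z) * exp (b * u + (a * u + b) * \<phi> z)"
      using fe[of u z] psi[of u] psi[of z] by simp
    then have "exp ((b * u + (a * u + b) * B - b * \<phi> u) + (b * \<phi> u + (a * \<phi> u + b) * z))
        = exp ((b * z + (a * z + b) * B - b * \<phi> z) + (b * u + (a * u + b) * \<phi> z))"
      using psi0 unfolding exp_add by simp
    then have "exp (((b * u + (a * u + b) * B - b * \<phi> u) + (b * \<phi> u + (a * \<phi> u + b) * z))
        - ((b * z + (a * z + b) * B - b * \<phi> z) + (b * u + (a * u + b) * \<phi> z))) = 1"
      by (simp only: exp_diff) simp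
    then show ?thesis by (simp add: algebra_simps)
  qed
  \<comment> \<open>From \<open>one\<close> alone the exponent is known only up to multiples of
    \<open>2 * pi * \<i>\<close>. Differentiation removes this ambiguity: the exponential factor is
    1 and the left side is constant in \<open>z\<close>.\<close>
  have phi: "\<phi> u = A * u + B" for u
  proof -
    have "(\<phi> has_field_derivative A) (at 0)"
      unfolding A_def using hol(2) by (simp add: holomorphic_derivI)
    then have "((\<lambda>z. exp (a * (z * (\<phi> u - B) - u * (\<phi> z - B)))) has_field_derivative
        exp (a * (0 * (\<phi> u - B) - u * (\<phi> 0 - B))) * (a * ((\<phi> u - B) - u * A))) (at 0)"
      by (auto intro!: derivative_eq_intros)
    then have "((\<lambda>z. 1) has_field_derivative (a * ((\<phi> u - B) - u * A))) (at 0)"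
      by (simp only: one mult_1)
    then have "a * ((\<phi> u - B) - u * A) = 0"
      using DERIV_unique DERIV_const by blast
    then have "\<phi> u - B - u * A = 0" using a by simp
    then show ?thesis by (simp add: algebra_simps)
  qed
  \<comment> \<open>With \<open>\<phi>\<close> affine the constants \<open>b * B\<close> cancel in
    the exponent, and the coefficient left at \<open>u\<close> is the required
    \<open>D\<close>.\<close>
  have "\<psi> u = \<psi> 0 * exp ((a * B - b * A + b) * u)" for u
    using psi[of u] by (simp add: phi[of u] algebra_simps)
  then show ?thesis using phi psi0 by blast
qed

end

section \<open>Power series against the Gaussian and dilations\<close>

text \<open>Zeros are isolated: a nonzero coefficient of the difference would keep its sum, which is
  0, away from 0 on a punctured disc. The coefficient of index 0 is read off at
  \<open>w = 0\<close>.\<close>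

lemma powser_coeffs_unique:
  fixes x y :: "nat \<Rightarrow> complex"
  assumes "\<And>w. (\<lambda>n. x n * w ^ n) sums F w" "\<And>w. (\<lambda>n. y n * w ^ n) sums F w"
  shows "x = y"
proof
  fix m
  define d where "d n = x n - y n" for n
  have sums: "(\<lambda>n. d n * w ^ n) sums 0" for w
    using sums_diff[OF assms(1,2)[of w]] by (simp add: d_def left_diff_distrib)
  have "d m = 0"
  proof (cases "m = 0")
    case True
    have "(\<lambda>n. d n * 0 ^ n) sums d 0" by (rule powser_sums_zero)
    then show ?thesis using sums[of 0] sums_unique2 True by blast
  next
    case False
    show ?thesis
    proof (rule ccontr)
      assume "d m \<noteq> 0"
      show False
      proof (rule powser_0_nonzero[of 1 0 d "\<lambda>_. 0" m])
        fix s :: real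
        assume "0 < s" and "\<And>z :: complex. z \<in> cball 0 s - {0} \<Longrightarrow> (0 :: complex) \<noteq> 0"
        from this(2)[of "of_real s"] this(1) show False by simp
      qed (use sums False \<open>d m \<noteq> 0\<close> in auto)
    qed
  qed
  then show "x m = y m" by (simp add: d_def)
qed

lemma power_le_fact_exp:
  fixes x :: real
  assumes "0 \<le> x"
  shows "x ^ n \<le> fact n * exp x"
proof -
  have "(\<Sum>k\<in>{n}. x ^ k /\<^sub>R fact k) \<le> exp x"
    unfolding exp_def using assms by (intro sum_le_suminf summable_exp_generic) auto
  then show ?thesis by (simp add: field_simps)
qed

lemma exp_partial_sum_bound:
  fixes x :: complex
  shows "cmod (\<Sum>n<N. x ^ n / fact n) \<le> exp (cmod x)"
proof -
  have "cmod (\<Sum>n<N. x ^ n / fact n) \<le> (\<Sum>n<N. cmod x ^ n /\<^sub>R fact n)"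
    by (rule sum_norm_le) (simp add: norm_mult norm_inverse norm_power divide_inverse mult.commute)
  also have "\<dots> \<le> exp (cmod x)"
    unfolding exp_def by (intro sum_le_suminf summable_exp_generic) auto
  finally show ?thesis .
qed

text \<open>A generating function of moments: summation turns the powers into
  \<open>exp ((p z + q) w)\<close>, so the integrand becomes a multiple of the kernel at
  \<open>cnj (D + p * w)\<close> times \<open>cnj (g z)\<close>, and the reproducing property
  evaluates it. The parameters are general enough to serve both sides of
  \<open>exp_affine_moments\<close>.\<close>

lemma fock_exp_moment_sums:
  assumes g: "g \<in> fock_space"
  shows "(\<lambda>n. (LINT z|gauss. C * exp (D * z) * (p * z + q) ^ n * cnj (g z)) / fact n * w ^ n) sums
     (C * exp (q * w) * cnj (g (cnj (D + p * w))))"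
proof -
  note [measurable] = fock_spaceD(2)[OF g] fock_spaceD(2)[OF fock_kernel_in_fock_space]
  have "(\<lambda>n. LINT z|gauss. C * exp (D * z) * (((p * z + q) * w) ^ n / fact n) * cnj (g z)) sums
      (LINT z|gauss. C * exp (D * z) * exp ((p * z + q) * w) * cnj (g z))"
  proof (rule sums_integral_dominated)
    show "integrable gauss (\<lambda>z. cmod C * exp (cmod q * cmod w) *
        exp (0 * (cmod z)\<^sup>2 + (cmod D + cmod p * cmod w) * cmod z) * cmod (g z))"
      by (rule integrable_gauss_growth_mult_fock[OF g]) simp
    fix N z
    have "cmod (\<Sum>n<N. C * exp (D * z) * (((p * z + q) * w) ^ n / fact n) * cnj (g z))
        = cmod C * cmod (exp (D * z)) * cmod (\<Sum>n<N. ((p * z + q) * w) ^ n / fact n) * cmod (g z)"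
      by (simp only: sum_distrib_left[symmetric] sum_distrib_right[symmetric] norm_mult complex_mod_cnj)
    also have "\<dots> \<le> cmod C * exp (cmod D * cmod z) * exp (cmod p * cmod z * cmod w + cmod q * cmod w) * cmod (g z)"
    proof (intro mult_right_mono mult_mono mult_nonneg_nonneg order_refl)
      show "cmod (exp (D * z)) \<le> exp (cmod D * cmod z)"
        using norm_exp[of "D * z"] by (simp add: norm_mult)
      have "cmod ((p * z + q) * w) \<le> cmod p * cmod z * cmod w + cmod q * cmod w"
        using norm_triangle_ineq[of "p * z * w" "q * w"] by (simp add: norm_mult distrib_right)
      then show "cmod (\<Sum>n<N. ((p * z + q) * w) ^ n / fact n) \<le> exp (cmod p * cmod z * cmod w + cmod q * cmod w)"
        using exp_partial_sum_bound order_trans exp_le_cancel_iff by blast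
    qed auto
    also have "\<dots> = cmod C * exp (cmod q * cmod w) *
        exp (0 * (cmod z)\<^sup>2 + (cmod D + cmod p * cmod w) * cmod z) * cmod (g z)"
      by (simp add: exp_add algebra_simps)
    finally show "cmod (\<Sum>n<N. C * exp (D * z) * (((p * z + q) * w) ^ n / fact n) * cnj (g z)) \<le> \<dots>" .
    have "(\<lambda>n. ((p * z + q) * w) ^ n / fact n) sums exp ((p * z + q) * w)"
      using exp_converges[of "(p * z + q) * w"] by (simp add: scaleR_conv_of_real divide_inverse mult.commute)
    then show "(\<lambda>n. C * exp (D * z) * (((p * z + q) * w) ^ n / fact n) * cnj (g z)) sums
        (C * exp (D * z) * exp ((p * z + q) * w) * cnj (g z))"
      by (intro sums_mult sums_mult2)
  qed simp_all
  moreover have "(LINT z|gauss. C * exp (D * z) * (((p * z + q) * w) ^ n / fact n) * cnj (g z))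
      = (LINT z|gauss. C * exp (D * z) * (p * z + q) ^ n * cnj (g z)) / fact n * w ^ n" for n
  proof -
    have "(LINT z|gauss. C * exp (D * z) * (((p * z + q) * w) ^ n / fact n) * cnj (g z))
        = (LINT z|gauss. w ^ n / fact n * (C * exp (D * z) * (p * z + q) ^ n * cnj (g z)))"
      by (rule Bochner_Integration.integral_cong) (simp_all add: power_mult_distrib mult_ac)
    also have "\<dots> = w ^ n / fact n * (LINT z|gauss. C * exp (D * z) * (p * z + q) ^ n * cnj (g z))"
      by (rule integral_mult_right_zero)
    finally show ?thesis by simp
  qed
  moreover have "(LINT z|gauss. C * exp (D * z) * exp ((p * z + q) * w) * cnj (g z))
      = C * exp (q * w) * cnj (g (cnj (D + p * w)))"
  proof -
    have "(LINT z|gauss. C * exp (D * z) * exp ((p * z + q) * w) * cnj (g z))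
        = (LINT z|gauss. (C * exp (q * w)) * (fock_kernel (cnj (D + p * w)) z * cnj (g z)))"
      by (rule Bochner_Integration.integral_cong)
         (simp_all add: fock_kernel_def distrib_right distrib_left exp_add mult_ac)
    also have "\<dots> = (C * exp (q * w)) * (LINT z|gauss. fock_kernel (cnj (D + p * w)) z * cnj (g z))"
      by (rule integral_mult_right_zero)
    also have "(LINT z|gauss. fock_kernel (cnj (D + p * w)) z * cnj (g z)) = fock_inner (fock_kernel (cnj (D + p * w))) g"
      by (simp add: fock_inner_eq)
    also have "\<dots> = cnj (g (cnj (D + p * w)))"
      by (simp only: fock_inner_commute[OF fock_kernel_in_fock_space g] fock_reproducing[OF g])
    finally show ?thesis .
  qed
  ultimately show ?thesis by simp
qed

text \<open>\<open>k\<close> may have the critical growth exponent \<open>1 / 2\<close>, with a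
  linear term \<open>\<kappa>\<close> from recentring or from a removed weight. The ratio
  \<open>s^2\<close> lowers the exponent of the partial sums to \<open>s^2 / 2\<close>, so that
  their product with \<open>exp (E * z)\<close> and a Fock function has an integrable
  majorant.\<close>

lemma fock_taylor_dilation_sums:
  assumes h: "h \<in> fock_space" and k: "k holomorphic_on UNIV"
    and s: "0 \<le> s" "s < 1" and \<kappa>: "0 \<le> \<kappa>"
    and bound: "\<And>u. cmod (k u) \<le> M * exp ((cmod u)\<^sup>2 / 2 + \<kappa> * cmod u)"
  shows "(\<lambda>n. (deriv ^^ n) k 0 / fact n * of_real (s\<^sup>2) ^ n * (LINT z|gauss. exp (E * z) * (z - q) ^ n * cnj (h z))) sums
     (LINT z|gauss. exp (E * z) * k (of_real (s\<^sup>2) * (z - q)) * cnj (h z))"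
proof -
  note [measurable] = fock_spaceD(2)[OF h] entire_borel_measurable[OF k]
  define d where "d n = (deriv ^^ n) k 0 / fact n" for n
  have M: "0 \<le> M"
    using order_trans[OF norm_ge_zero bound[of 0]] by simp
  have "(\<lambda>n. LINT z|gauss. exp (E * z) * (d n * (of_real (s\<^sup>2) * (z - q)) ^ n) * cnj (h z)) sums
     (LINT z|gauss. exp (E * z) * k (of_real (s\<^sup>2) * (z - q)) * cnj (h z))"
  proof (rule sums_integral_dominated)
    show "integrable gauss (\<lambda>z. M / (1 - s) * exp ((cmod q)\<^sup>2 / 2 + \<kappa> * cmod q) *
        exp (s\<^sup>2 / 2 * (cmod z)\<^sup>2 + (cmod E + cmod q + \<kappa>) * cmod z) * cmod (h z))"
      using s by (intro integrable_gauss_growth_mult_fock[OF h]) (simp add: power_less_one_iff)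
    fix N z
    have "cmod (\<Sum>n<N. exp (E * z) * (d n * (of_real (s\<^sup>2) * (z - q)) ^ n) * cnj (h z))
        = cmod (exp (E * z)) * cmod (\<Sum>n<N. d n * (of_real (s\<^sup>2) * (z - q)) ^ n) * cmod (h z)"
      by (simp only: sum_distrib_left[symmetric] sum_distrib_right[symmetric] norm_mult complex_mod_cnj)
    also have "\<dots> \<le> exp (cmod E * cmod z) * (M * exp ((s * cmod (z - q))\<^sup>2 / 2 + \<kappa> * (s * cmod (z - q))) / (1 - s)) * cmod (h z)"
    proof (intro mult_right_mono mult_mono mult_nonneg_nonneg)
      show "cmod (exp (E * z)) \<le> exp (cmod E * cmod z)"
        using norm_exp[of "E * z"] by (simp add: norm_mult)
      show "cmod (\<Sum>n<N. d n * (of_real (s\<^sup>2) * (z - q)) ^ n) \<le> M * exp ((s * cmod (z - q))\<^sup>2 / 2 + \<kappa> * (s * cmod (z - q))) / (1 - s)"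
        unfolding d_def by (rule entire_taylor_partial_sum_bound[OF k s bound])
    qed auto
    also have "\<dots> = M / (1 - s) * (exp (cmod E * cmod z) * exp ((s * cmod (z - q))\<^sup>2 / 2 + \<kappa> * (s * cmod (z - q)))) * cmod (h z)"
      by simp
    also have "\<dots> \<le> M / (1 - s) * (exp ((cmod q)\<^sup>2 / 2 + \<kappa> * cmod q) * exp (s\<^sup>2 / 2 * (cmod z)\<^sup>2 + (cmod E + cmod q + \<kappa>) * cmod z)) * cmod (h z)"
    proof (intro mult_right_mono mult_left_mono)
      \<comment> \<open>Recentring at \<open>q\<close> costs only a constant and a term linear in
        \<open>cmod z\<close>; the quadratic coefficient stays \<open>s^2 / 2\<close>.\<close>
      have zq: "cmod (z - q) \<le> cmod z + cmod q" by (rule norm_triangle_ineq4)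
      have "s * cmod (z - q) \<le> 1 * (cmod z + cmod q)"
        using s zq by (intro mult_mono) auto
      then have 1: "\<kappa> * (s * cmod (z - q)) \<le> \<kappa> * (cmod z + cmod q)"
        using \<kappa> by (intro mult_left_mono) auto
      have "(s * cmod (z - q))\<^sup>2 \<le> s\<^sup>2 * (cmod z + cmod q)\<^sup>2"
        using zq by (simp add: power_mult_distrib mult_left_mono power_mono)
      also have "\<dots> = s\<^sup>2 * (cmod z)\<^sup>2 + s\<^sup>2 * (2 * cmod z * cmod q + (cmod q)\<^sup>2)"
        by (simp add: power2_sum algebra_simps)
      also have "\<dots> \<le> s\<^sup>2 * (cmod z)\<^sup>2 + 1 * (2 * cmod z * cmod q + (cmod q)\<^sup>2)"
        using s by (intro add_left_mono mult_right_mono) (auto simp: power_le_one)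
      finally have "cmod E * cmod z + ((s * cmod (z - q))\<^sup>2 / 2 + \<kappa> * (s * cmod (z - q)))
          \<le> ((cmod q)\<^sup>2 / 2 + \<kappa> * cmod q) + (s\<^sup>2 / 2 * (cmod z)\<^sup>2 + (cmod E + cmod q + \<kappa>) * cmod z)"
        using 1 by (simp add: algebra_simps)
      then show "exp (cmod E * cmod z) * exp ((s * cmod (z - q))\<^sup>2 / 2 + \<kappa> * (s * cmod (z - q)))
          \<le> exp ((cmod q)\<^sup>2 / 2 + \<kappa> * cmod q) * exp (s\<^sup>2 / 2 * (cmod z)\<^sup>2 + (cmod E + cmod q + \<kappa>) * cmod z)"
        unfolding exp_add[symmetric] by simp
    qed (use M s in auto)
    finally show "cmod (\<Sum>n<N. exp (E * z) * (d n * (of_real (s\<^sup>2) * (z - q)) ^ n) * cnj (h z)) \<le>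
        M / (1 - s) * exp ((cmod q)\<^sup>2 / 2 + \<kappa> * cmod q) *
        exp (s\<^sup>2 / 2 * (cmod z)\<^sup>2 + (cmod E + cmod q + \<kappa>) * cmod z) * cmod (h z)"
      by (simp only: mult.assoc)
    show "(\<lambda>n. exp (E * z) * (d n * (of_real (s\<^sup>2) * (z - q)) ^ n) * cnj (h z)) sums
        (exp (E * z) * k (of_real (s\<^sup>2) * (z - q)) * cnj (h z))"
      unfolding d_def using entire_taylor_sums[OF k, of 0] by (intro sums_mult sums_mult2) simp
  qed simp_all
  moreover have "(LINT z|gauss. exp (E * z) * (d n * (of_real (s\<^sup>2) * (z - q)) ^ n) * cnj (h z))
      = d n * of_real (s\<^sup>2) ^ n * (LINT z|gauss. exp (E * z) * (z - q) ^ n * cnj (h z))" for n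
  proof -
    have "(LINT z|gauss. exp (E * z) * (d n * (of_real (s\<^sup>2) * (z - q)) ^ n) * cnj (h z))
        = (LINT z|gauss. d n * of_real (s\<^sup>2) ^ n * (exp (E * z) * (z - q) ^ n * cnj (h z)))"
      by (rule Bochner_Integration.integral_cong) (simp_all add: power_mult_distrib mult_ac)
    also have "\<dots> = d n * of_real (s\<^sup>2) ^ n * (LINT z|gauss. exp (E * z) * (z - q) ^ n * cnj (h z))"
      by (rule integral_mult_right_zero)
    finally show ?thesis .
  qed
  ultimately show ?thesis by (simp add: d_def)
qed

lemma fock_inner_tendsto:
  assumes "\<And>n. X n \<in> fock_space" "f \<in> fock_space" "g \<in> fock_space" "fock_tendsto X f"
  shows "(\<lambda>n. fock_inner (X n) g) \<longlonglongrightarrow> fock_inner f g"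
proof (rule LIM_zero_cancel, rule Lim_null_comparison)
  show "\<forall>\<^sub>F n in sequentially. cmod (fock_inner (X n) g - fock_inner f g) \<le> fock_norm (\<lambda>z. X n z - f z) * fock_norm g"
    using fock_Cauchy_Schwarz[OF fock_space_diff[OF assms(1,2)] assms(3)]
    by (intro always_eventually) (simp add: fock_inner_diff_left[OF assms(1,2,3)])
  show "(\<lambda>n. fock_norm (\<lambda>z. X n z - f z) * fock_norm g) \<longlonglongrightarrow> 0"
    using assms(4) unfolding fock_tendsto_def by (rule tendsto_mult_left_zero)
qed

text \<open>One family for both sides of the duality: \<open>E = 0\<close> with centre
  \<open>B\<close> gives the dilate of \<open>f\<close>, and \<open>E = D\<close> with centre 0,
  applied to \<open>T f\<close>, gives its image under the operator.\<close>

definition fock_dilation :: "complex \<Rightarrow> complex \<Rightarrow> real \<Rightarrow> (complex \<Rightarrow> complex) \<Rightarrow> complex \<Rightarrow> complex" where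
  "fock_dilation E B r f = (\<lambda>z. exp (E * of_real (1 - r) * z) * f (of_real r * z + of_real (1 - r) * B))"

text \<open>By convexity \<open>|r z + (1 - r) B|^2 \<le> r |z|^2 + (1 - r) |B|^2\<close>, which
  leaves a spare Gaussian exponent \<open>(1 - r) |z|^2\<close> to absorb the weight
  \<open>2 (1 - r) |E| |z|\<close>. What remains in the exponent carries the factor
  \<open>1 - r\<close>, and \<open>1 / r^2\<close> is the Jacobian, so the constant tends to 1 with
  \<open>r\<close>.\<close>

lemma fock_dilation_bound:
  fixes r :: real
  assumes f: "f \<in> fock_space" and r: "0 < r" "r < 1"
  shows "fock_dilation E B r f \<in> fock_space"
    and "(LINT z|gauss. (cmod (fock_dilation E B r f z))\<^sup>2) \<le>
      exp ((1 - r) * ((cmod E + cmod B)\<^sup>2 + (cmod B)\<^sup>2)) / r\<^sup>2 * (LINT z|gauss. (cmod (f z))\<^sup>2)"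
proof -
  define K where "K = (cmod E + cmod B)\<^sup>2 + (cmod B)\<^sup>2"
  define F where "F u = exp (- (cmod u)\<^sup>2) * (cmod (f u))\<^sup>2" for u
  note [measurable] = fock_spaceD(2)[OF f]
  have F: "integrable lborel F"
    using fock_spaceD(3)[OF f] by (simp add: integrable_gauss_iff F_def[abs_def])
  have hol: "fock_dilation E B r f holomorphic_on UNIV"
    unfolding fock_dilation_def by (intro holomorphic_intros entire_compose[OF fock_spaceD(1)[OF f]])
  note [measurable] = entire_borel_measurable[OF hol]
  note FT = integrable_lborel_scale[OF r(1) F, of "of_real (1 - r) * B"]
  have le: "exp (- (cmod z)\<^sup>2) * (cmod (fock_dilation E B r f z))\<^sup>2 \<le> exp ((1 - r) * K) * F (of_real r * z + of_real (1 - r) * B)" for z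
  proof -
    define x e y where "x = cmod z" and "e = cmod E" and "y = cmod B"
    have nn: "0 \<le> x" "0 \<le> e" "0 \<le> y" by (simp_all add: x_def e_def y_def)
    define v where "v = cmod (of_real r * z + of_real (1 - r) * B)"
    have "v \<le> r * x + (1 - r) * y"
      unfolding v_def x_def y_def
      using norm_triangle_ineq[of "of_real r * z" "of_real (1 - r) * B"] r by (simp add: norm_mult del: of_real_diff)
    then have "v\<^sup>2 \<le> (r * x + (1 - r) * y)\<^sup>2"
      by (intro power_mono) (simp_all add: v_def)
    also have "\<dots> = r * x\<^sup>2 + (1 - r) * y\<^sup>2 - r * (1 - r) * (x - y)\<^sup>2"
      by (simp add: power2_eq_square algebra_simps)
    also have "\<dots> \<le> r * x\<^sup>2 + (1 - r) * y\<^sup>2"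
      using r by simp
    finally have v: "v\<^sup>2 \<le> r * x\<^sup>2 + (1 - r) * y\<^sup>2" .
    have "2 * e * x \<le> e\<^sup>2 + x\<^sup>2" by (rule sum_squares_bound)
    also have "\<dots> \<le> (e + y)\<^sup>2 + x\<^sup>2" using nn by (simp add: power_mono)
    finally have "(1 - r) * (2 * e * x) \<le> (1 - r) * ((e + y)\<^sup>2 + x\<^sup>2)"
      using r by (intro mult_left_mono) auto
    with v have "- x\<^sup>2 + 2 * ((1 - r) * e * x) \<le> (1 - r) * K + - v\<^sup>2"
      by (simp add: K_def e_def[symmetric] y_def[symmetric] algebra_simps)
    then have *: "exp (- x\<^sup>2) * exp (2 * ((1 - r) * e * x)) \<le> exp ((1 - r) * K) * exp (- v\<^sup>2)"
      unfolding exp_add[symmetric] by simp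
    have "cmod (exp (E * of_real (1 - r) * z)) \<le> exp ((1 - r) * e * x)"
      using norm_exp[of "E * of_real (1 - r) * z"] r
      by (simp add: norm_mult e_def x_def mult_ac del: of_real_diff)
    then have "(cmod (exp (E * of_real (1 - r) * z)))\<^sup>2 \<le> exp (2 * ((1 - r) * e * x))"
      unfolding exp_double by (intro power_mono) auto
    then have "exp (- x\<^sup>2) * (cmod (exp (E * of_real (1 - r) * z)))\<^sup>2 \<le> exp ((1 - r) * K) * exp (- v\<^sup>2)"
      using * by (meson exp_ge_zero mult_left_mono order_trans)
    then have "exp (- x\<^sup>2) * (cmod (exp (E * of_real (1 - r) * z)))\<^sup>2 * (cmod (f (of_real r * z + of_real (1 - r) * B)))\<^sup>2
        \<le> exp ((1 - r) * K) * exp (- v\<^sup>2) * (cmod (f (of_real r * z + of_real (1 - r) * B)))\<^sup>2"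
      by (rule mult_right_mono) simp
    then show ?thesis
      by (simp only: fock_dilation_def norm_mult power_mult_distrib F_def v_def x_def mult.assoc)
  qed
  have int: "integrable lborel (\<lambda>z. exp (- (cmod z)\<^sup>2) * (cmod (fock_dilation E B r f z))\<^sup>2)"
  proof (rule Bochner_Integration.integrable_bound)
    show "integrable lborel (\<lambda>z. exp ((1 - r) * K) * F (of_real r * z + of_real (1 - r) * B))"
      using FT(1) by simp
    show "AE z in lborel. norm (exp (- (cmod z)\<^sup>2) * (cmod (fock_dilation E B r f z))\<^sup>2) \<le>
        norm (exp ((1 - r) * K) * F (of_real r * z + of_real (1 - r) * B))"
      using le order_trans[OF le abs_ge_self] by (intro AE_I2) (simp add: abs_mult)
  qed measurable
  show "fock_dilation E B r f \<in> fock_space"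
    using int hol by (simp add: fock_space_def mult.commute)
  have "(LINT z|lborel. exp (- (cmod z)\<^sup>2) * (cmod (fock_dilation E B r f z))\<^sup>2)
      \<le> (LINT z|lborel. exp ((1 - r) * K) * F (of_real r * z + of_real (1 - r) * B))"
    using FT(1) by (intro integral_mono int le) simp
  also have "\<dots> = exp ((1 - r) * K) / r\<^sup>2 * (LINT z|lborel. F z)"
    using FT(2) by simp
  finally show "(LINT z|gauss. (cmod (fock_dilation E B r f z))\<^sup>2) \<le>
      exp ((1 - r) * ((cmod E + cmod B)\<^sup>2 + (cmod B)\<^sup>2)) / r\<^sup>2 * (LINT z|gauss. (cmod (f z))\<^sup>2)"
    unfolding K_def[symmetric] using pi_gt_zero
    by (simp add: integral_gauss F_def[abs_def] divide_right_mono flip: divide_divide_eq_left)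
qed

lemma fock_dilation_tendsto:
  fixes r :: "nat \<Rightarrow> real"
  assumes f: "f \<in> fock_space" and r: "\<And>j. 0 < r j" "\<And>j. r j < 1" and lim: "r \<longlonglongrightarrow> 1"
  shows "fock_tendsto (\<lambda>j. fock_dilation E B (r j) f) f"
proof -
  note dil = fock_dilation_bound[OF f r]
  note [measurable] = fock_spaceD(2)[OF f] fock_spaceD(2)[OF dil(1)]
  have "(\<lambda>j. LINT z|gauss. (cmod (fock_dilation E B (r j) f z - f z))\<^sup>2) \<longlonglongrightarrow> 0"
  proof (rule L2_tendsto_of_norm_bound)
    show "(LINT z|gauss. (cmod (fock_dilation E B (r j) f z))\<^sup>2) \<le>
        exp ((1 - r j) * ((cmod E + cmod B)\<^sup>2 + (cmod B)\<^sup>2)) / (r j)\<^sup>2 * (LINT z|gauss. (cmod (f z))\<^sup>2)" for j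
      by (rule dil)
    have "(\<lambda>j. exp ((1 - r j) * ((cmod E + cmod B)\<^sup>2 + (cmod B)\<^sup>2)) / (r j)\<^sup>2) \<longlonglongrightarrow>
        exp ((1 - 1) * ((cmod E + cmod B)\<^sup>2 + (cmod B)\<^sup>2)) / 1\<^sup>2"
      by (intro tendsto_intros lim) simp
    then show "(\<lambda>j. exp ((1 - r j) * ((cmod E + cmod B)\<^sup>2 + (cmod B)\<^sup>2)) / (r j)\<^sup>2) \<longlonglongrightarrow> 1"
      by simp
    fix z
    have "isCont f (of_real 1 * z + of_real (1 - 1) * B)"
      using fock_spaceD(1)[OF f] holomorphic_on_imp_continuous_on continuous_on_eq_continuous_at open_UNIV by blast
    then have "(\<lambda>j. fock_dilation E B (r j) f z) \<longlonglongrightarrow> exp (E * of_real (1 - 1) * z) * f (of_real 1 * z + of_real (1 - 1) * B)"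
      unfolding fock_dilation_def
      by (intro tendsto_mult tendsto_exp tendsto_const tendsto_of_real tendsto_diff lim
          isCont_tendsto_compose[of _ f] tendsto_add)
    then show "(\<lambda>j. fock_dilation E B (r j) f z) \<longlonglongrightarrow> f z" by simp
  qed (use fock_spaceD[OF f] fock_spaceD[OF dil(1)] in auto)
  then have "(\<lambda>j. sqrt (LINT z|gauss. (cmod (fock_dilation E B (r j) f z - f z))\<^sup>2)) \<longlonglongrightarrow> sqrt 0"
    by (rule tendsto_real_sqrt)
  then show ?thesis
    unfolding fock_tendsto_def by (simp add: fock_norm_eq)
qed

section \<open>Exponential weights with affine symbols\<close>

text \<open>The ratios come as squares to match the splitting of the dilation factor in
  \<open>entire_taylor_partial_sum_bound\<close>.\<close>

lemma unit_squares_tendsto_1: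
  "\<exists>s :: nat \<Rightarrow> real. (\<forall>j. 0 < s j) \<and> (\<forall>j. s j < 1) \<and> (\<lambda>j. (s j)\<^sup>2) \<longlonglongrightarrow> 1"
proof -
  have "(\<lambda>j. inverse (real (Suc (Suc j)))) \<longlonglongrightarrow> 0"
    using LIMSEQ_inverse_real_of_nat by (rule LIMSEQ_Suc)
  then have "(\<lambda>j. (1 - inverse (real (Suc (Suc j))))\<^sup>2) \<longlonglongrightarrow> (1 - 0)\<^sup>2"
    by (intro tendsto_intros)
  then show ?thesis
    by (intro exI[of _ "\<lambda>j. 1 - inverse (real (Suc (Suc j)))"]) (auto simp: field_simps)
qed

text \<open>Kernels go to multiples of kernels. They therefore lie in the maximal domain, and
  testing the adjoint against them reveals its weight and symbol.\<close>

lemma weighted_comp_kernel: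
  "weighted_comp (\<lambda>z. C * exp (D * z)) (\<lambda>z. A * z + B) (fock_kernel w) =
     (\<lambda>z. C * exp (cnj w * B) * fock_kernel (cnj D + cnj A * w) z)"
  by (simp add: weighted_comp_def fock_kernel_def fun_eq_iff algebra_simps exp_add)

lemma adjoint_exp_affine_app:
  assumes dense: "densely_defined (W_max (\<lambda>z. C * exp (D * z)) (\<lambda>z. A * z + B))"
    and g: "g \<in> op_dom (adjoint_op (W_max (\<lambda>z. C * exp (D * z)) (\<lambda>z. A * z + B)))"
  shows "op_app (adjoint_op (W_max (\<lambda>z. C * exp (D * z)) (\<lambda>z. A * z + B))) g =
    weighted_comp (\<lambda>z. cnj C * exp (cnj B * z)) (\<lambda>z. cnj A * z + cnj D) g"
proof
  fix w
  let ?T = "W_max (\<lambda>z. C * exp (D * z)) (\<lambda>z. A * z + B)"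
  have gF: "g \<in> fock_space" and adjF: "op_app (adjoint_op ?T) g \<in> fock_space"
    and adj: "\<And>f. f \<in> op_dom ?T \<Longrightarrow> fock_inner (op_app ?T f) g = fock_inner f (op_app (adjoint_op ?T) g)"
    using adjoint_op_domE[OF dense W_max_range g] by blast+
  have K: "fock_kernel w \<in> op_dom ?T"
    by (simp add: weighted_comp_kernel fock_space_cmult)
  have "op_app (adjoint_op ?T) g w = fock_inner (op_app (adjoint_op ?T) g) (fock_kernel w)"
    by (rule fock_reproducing[OF adjF, symmetric])
  also have "\<dots> = cnj (fock_inner (op_app ?T (fock_kernel w)) g)"
    by (subst fock_inner_commute) (use adjF adj[OF K] in auto)
  also have "\<dots> = fock_inner g (op_app ?T (fock_kernel w))"
    by (rule fock_inner_commute[symmetric, OF gF]) (use K in auto)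
  also have "\<dots> = weighted_comp (\<lambda>z. cnj C * exp (cnj B * z)) (\<lambda>z. cnj A * z + cnj D) g w"
    by (simp add: weighted_comp_kernel fock_inner_scaled_kernel[OF gF])
       (simp add: weighted_comp_def exp_cnj mult.commute add.commute)
  finally show "op_app (adjoint_op ?T) g w =
      weighted_comp (\<lambda>z. cnj C * exp (cnj B * z)) (\<lambda>z. cnj A * z + cnj D) g w" .
qed

text \<open>This is the duality for \<open>f = (z - B) ^ n\<close>, which the operator sends to
  \<open>C * exp (D * z) * (A * z) ^ n\<close>. The two generating functions agree because the
  factor \<open>exp (- B * w)\<close> of the shift cancels the conjugated weight of
  \<open>S\<close>.\<close>

lemma exp_affine_moments:
  assumes g: "g \<in> fock_space"
    and Sg: "weighted_comp (\<lambda>z. cnj C * exp (cnj B * z)) (\<lambda>z. cnj A * z + cnj D) g \<in> fock_space"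
  shows "(LINT z|gauss. (z - B) ^ n * cnj (weighted_comp (\<lambda>z. cnj C * exp (cnj B * z)) (\<lambda>z. cnj A * z + cnj D) g z))
    = (LINT z|gauss. C * exp (D * z) * (A * z) ^ n * cnj (g z))"
proof -
  let ?S = "weighted_comp (\<lambda>z. cnj C * exp (cnj B * z)) (\<lambda>z. cnj A * z + cnj D) g"
  have "1 * exp (- B * w) * cnj (?S (cnj (0 + 1 * w))) = C * exp (0 * w) * cnj (g (cnj (D + A * w)))" for w
    by (simp add: weighted_comp_def exp_cnj exp_minus add.commute)
  then have "(\<lambda>n. (LINT z|gauss. 1 * exp (0 * z) * (1 * z + - B) ^ n * cnj (?S z)) / fact n)
      = (\<lambda>n. (LINT z|gauss. C * exp (D * z) * (A * z + 0) ^ n * cnj (g z)) / fact n)"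
    using fock_exp_moment_sums[OF Sg, of 1 0 1 "- B"] fock_exp_moment_sums[OF g, of C D A 0]
    by (intro powser_coeffs_unique[of _ "\<lambda>w. C * exp (0 * w) * cnj (g (cnj (D + A * w)))"]) simp_all
  from fun_cong[OF this, of n] show ?thesis by simp
qed

text \<open>
  \<open>f(r z + (1 - r) B)\<close> is mapped by the operator to \<open>exp (D (1 - r) z) (W f)(r z)\<close>. Both are
  power series dominated well inside the Gaussian, so that the duality may be checked term by
  term on the polynomials \<open>(z - B)\<^sup>n\<close>; then \<open>r\<close> tends to 1.
\<close>

lemma exp_affine_duality:
  assumes f: "f \<in> fock_space"
    and Tf: "weighted_comp (\<lambda>z. C * exp (D * z)) (\<lambda>z. A * z + B) f \<in> fock_space"
    and g: "g \<in> fock_space"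
    and Sg: "weighted_comp (\<lambda>z. cnj C * exp (cnj B * z)) (\<lambda>z. cnj A * z + cnj D) g \<in> fock_space"
  shows "fock_inner (weighted_comp (\<lambda>z. C * exp (D * z)) (\<lambda>z. A * z + B) f) g =
    fock_inner f (weighted_comp (\<lambda>z. cnj C * exp (cnj B * z)) (\<lambda>z. cnj A * z + cnj D) g)"
proof -
  define T where "T = weighted_comp (\<lambda>z. C * exp (D * z)) (\<lambda>z. A * z + B) f"
  define S where "S = weighted_comp (\<lambda>z. cnj C * exp (cnj B * z)) (\<lambda>z. cnj A * z + cnj D) g"
  have TF: "T \<in> fock_space" and SF: "S \<in> fock_space"
    using Tf Sg by (simp_all add: T_def S_def)
  \<comment> \<open>\<open>k\<close> is \<open>f\<close> recentred at \<open>B\<close>, and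
    \<open>l\<close> is \<open>T\<close> stripped of the weight \<open>exp (D * u)\<close>; the
    Taylor coefficients of \<open>l\<close> at 0 are those of \<open>k\<close> times
    \<open>C * A ^ n\<close>.\<close>
  define k where "k u = f (u + B)" for u
  define l where "l u = C * k (A * u)" for u
  have k: "k holomorphic_on UNIV"
    unfolding k_def by (intro entire_compose[OF fock_spaceD(1)[OF f]] holomorphic_intros)
  have l: "l holomorphic_on UNIV"
    unfolding l_def by (intro holomorphic_intros entire_compose[OF k])
  have coeff: "(deriv ^^ n) l 0 = C * A ^ n * (deriv ^^ n) k 0" for n
  proof -
    have "(deriv ^^ n) l 0 = C * (deriv ^^ n) (\<lambda>u. k (A * u)) 0"
      unfolding l_def
      by (rule higher_deriv_cmult[of _ UNIV]) (auto intro!: entire_compose[OF k] holomorphic_intros)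
    also have "(deriv ^^ n) (\<lambda>u. k (A * u)) 0 = A ^ n * (deriv ^^ n) k (A * 0)"
      by (rule higher_deriv_compose_linear[OF k, of UNIV]) auto
    finally show ?thesis by simp
  qed
  have k_bound: "cmod (k u) \<le> (fock_norm f * exp ((cmod B)\<^sup>2 / 2)) * exp ((cmod u)\<^sup>2 / 2 + cmod B * cmod u)" for u
  proof -
    have "(cmod (u + B))\<^sup>2 \<le> (cmod u + cmod B)\<^sup>2"
      by (intro power_mono norm_triangle_ineq) simp
    then have "(cmod (u + B))\<^sup>2 / 2 \<le> (cmod B)\<^sup>2 / 2 + ((cmod u)\<^sup>2 / 2 + cmod B * cmod u)"
      by (simp add: power2_sum algebra_simps)
    then have "exp ((cmod (u + B))\<^sup>2 / 2) \<le> exp ((cmod B)\<^sup>2 / 2) * exp ((cmod u)\<^sup>2 / 2 + cmod B * cmod u)"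
      unfolding exp_add[symmetric] by simp
    then have "fock_norm f * exp ((cmod (u + B))\<^sup>2 / 2) \<le>
        fock_norm f * (exp ((cmod B)\<^sup>2 / 2) * exp ((cmod u)\<^sup>2 / 2 + cmod B * cmod u))"
      by (intro mult_left_mono fock_norm_nonneg f)
    then show ?thesis
      unfolding k_def mult.assoc using fock_pointwise_bound[OF f] by (rule order_trans[rotated])
  qed
  have Tl: "T u = exp (D * u) * l u" for u
    by (simp add: T_def weighted_comp_def l_def k_def)
  \<comment> \<open>This comes from \<open>T\<close> being in the Fock space. The bound on
    \<open>k\<close> would only give the exponent \<open>|A u|^2 / 2\<close>, which is too large
    when \<open>|A| > 1\<close>.\<close>
  have l_bound: "cmod (l u) \<le> fock_norm T * exp ((cmod u)\<^sup>2 / 2 + cmod D * cmod u)" for u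
  proof -
    have "l u = exp (- (D * u)) * T u"
      by (simp add: Tl exp_minus)
    then have "cmod (l u) = cmod (exp (- (D * u))) * cmod (T u)"
      by (simp add: norm_mult)
    also have "\<dots> \<le> exp (cmod D * cmod u) * (fock_norm T * exp ((cmod u)\<^sup>2 / 2))"
      using norm_exp[of "- (D * u)"] fock_pointwise_bound[OF TF]
      by (intro mult_mono) (auto simp: norm_mult)
    finally show ?thesis by (simp add: exp_add mult_ac)
  qed
  have dual: "fock_inner (fock_dilation D 0 (s\<^sup>2) T) g = fock_inner (fock_dilation 0 B (s\<^sup>2) f) S"
    if s: "0 < s" "s < 1" for s
  proof -
    have r: "0 < s\<^sup>2" "s\<^sup>2 < 1" using s by (auto simp: power_less_one_iff)
    note [measurable] = fock_spaceD(2)[OF g] fock_spaceD(2)[OF SF]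
      fock_spaceD(2)[OF fock_dilation_bound(1)[OF TF r]] fock_spaceD(2)[OF fock_dilation_bound(1)[OF f r]]
    \<comment> \<open>The extra factor \<open>exp (D * (1 - r) * z)\<close> restores the full weight
      \<open>exp (D * z)\<close>, so only \<open>l\<close> is dilated.\<close>
    have 1: "fock_dilation D 0 (s\<^sup>2) T z = exp (D * z) * l (of_real (s\<^sup>2) * (z - 0))" for z
      by (simp add: fock_dilation_def Tl algebra_simps flip: exp_add mult.assoc)
    have 2: "fock_dilation 0 B (s\<^sup>2) f z = exp (0 * z) * k (of_real (s\<^sup>2) * (z - B))" for z
      by (simp add: fock_dilation_def k_def algebra_simps)
    have A: "(\<lambda>n. (deriv ^^ n) l 0 / fact n * of_real (s\<^sup>2) ^ n * (LINT z|gauss. exp (D * z) * (z - 0) ^ n * cnj (g z))) sums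
        fock_inner (fock_dilation D 0 (s\<^sup>2) T) g"
      using fock_taylor_dilation_sums[OF g l _ s(2) norm_ge_zero l_bound, of D 0] s
      by (simp add: fock_inner_eq 1)
    have B: "(\<lambda>n. (deriv ^^ n) k 0 / fact n * of_real (s\<^sup>2) ^ n * (LINT z|gauss. exp (0 * z) * (z - B) ^ n * cnj (S z))) sums
        fock_inner (fock_dilation 0 B (s\<^sup>2) f) S"
      using fock_taylor_dilation_sums[OF SF k _ s(2) norm_ge_zero k_bound, of 0 B] s
      by (simp add: fock_inner_eq 2)
    have term_eq: "(deriv ^^ n) l 0 / fact n * of_real (s\<^sup>2) ^ n * (LINT z|gauss. exp (D * z) * (z - 0) ^ n * cnj (g z))
        = (deriv ^^ n) k 0 / fact n * of_real (s\<^sup>2) ^ n * (LINT z|gauss. exp (0 * z) * (z - B) ^ n * cnj (S z))" for n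
    proof -
      have "C * A ^ n * (LINT z|gauss. exp (D * z) * (z - 0) ^ n * cnj (g z))
          = (LINT z|gauss. C * A ^ n * (exp (D * z) * (z - 0) ^ n * cnj (g z)))"
        by (rule integral_mult_right_zero[symmetric])
      also have "\<dots> = (LINT z|gauss. C * exp (D * z) * (A * z) ^ n * cnj (g z))"
        by (rule Bochner_Integration.integral_cong) (simp_all add: power_mult_distrib mult_ac)
      also have "\<dots> = (LINT z|gauss. exp (0 * z) * (z - B) ^ n * cnj (S z))"
        using exp_affine_moments[OF g Sg, of n] by (simp add: S_def)
      finally have *: "C * A ^ n * (LINT z|gauss. exp (D * z) * (z - 0) ^ n * cnj (g z))
          = (LINT z|gauss. exp (0 * z) * (z - B) ^ n * cnj (S z))" .
      show ?thesis unfolding coeff *[symmetric] by simp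
    qed
    show ?thesis
      using A[unfolded term_eq] B by (rule sums_unique2)
  qed
  obtain s :: "nat \<Rightarrow> real" where s: "\<And>j. 0 < s j" "\<And>j. s j < 1"
    and lim: "(\<lambda>j. (s j)\<^sup>2) \<longlonglongrightarrow> 1"
    using unit_squares_tendsto_1 by blast
  have r: "0 < (s j)\<^sup>2" "(s j)\<^sup>2 < 1" for j
    using s[of j] by (auto simp: power_less_one_iff)
  have "(\<lambda>j. fock_inner (fock_dilation D 0 ((s j)\<^sup>2) T) g) \<longlonglongrightarrow> fock_inner T g"
    by (intro fock_inner_tendsto fock_dilation_tendsto fock_dilation_bound TF g r lim)
  moreover have "(\<lambda>j. fock_inner (fock_dilation 0 B ((s j)\<^sup>2) f) S) \<longlonglongrightarrow> fock_inner f S"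
    by (intro fock_inner_tendsto fock_dilation_tendsto fock_dilation_bound f SF r lim)
  ultimately have "fock_inner T g = fock_inner f S"
    using dual[OF s] LIMSEQ_unique by simp
  then show ?thesis by (simp add: T_def S_def)
qed

section \<open>Density of the polynomials\<close>

lemma exp_affine_power_in_fock_space: "(\<lambda>z. C * exp (D * z) * (A * z + B) ^ n) \<in> fock_space"
proof (rule fock_space_growthI[where \<beta> = 0])
  show "(\<lambda>z. C * exp (D * z) * (A * z + B) ^ n) holomorphic_on UNIV"
    by (intro holomorphic_intros)
  fix z
  have "cmod (A * z + B) \<le> cmod A * cmod z + cmod B"
    using norm_triangle_ineq[of "A * z" B] by (simp add: norm_mult)
  then have "cmod (A * z + B) ^ n \<le> (cmod A * cmod z + cmod B) ^ n"
    by (rule power_mono) simp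
  also have "\<dots> \<le> fact n * exp (cmod A * cmod z + cmod B)"
    by (rule power_le_fact_exp) simp
  finally have "cmod C * cmod (exp (D * z)) * cmod (A * z + B) ^ n
      \<le> cmod C * exp (cmod D * cmod z) * (fact n * exp (cmod A * cmod z + cmod B))"
    using norm_exp[of "D * z"] by (intro mult_mono) (auto simp: norm_mult)
  also have "\<dots> = (cmod C * fact n * exp (cmod B)) * exp (0 * (cmod z)\<^sup>2 + (cmod D + cmod A) * cmod z)"
    by (simp add: exp_add algebra_simps)
  finally show "cmod (C * exp (D * z) * (A * z + B) ^ n) \<le>
      (cmod C * fact n * exp (cmod B)) * exp (0 * (cmod z)\<^sup>2 + (cmod D + cmod A) * cmod z)"
    by (simp add: norm_mult norm_power)
qed simp

lemma polynomial_in_dom_exp_affine: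
  "(\<lambda>z. \<Sum>n<N. d n * z ^ n) \<in> op_dom (W_max (\<lambda>z. C * exp (D * z)) (\<lambda>z. A * z + B))"
proof (induction N)
  case 0
  then show ?case by (simp add: weighted_comp_def)
next
  case (Suc N)
  let ?T = "W_max (\<lambda>z. C * exp (D * z)) (\<lambda>z. A * z + B)"
  have "(\<lambda>z. z ^ N) \<in> op_dom ?T"
    using exp_affine_power_in_fock_space[of 1 0 1 0 N] exp_affine_power_in_fock_space[of C D A B N]
    by (simp add: weighted_comp_def)
  from W_max_dom_lincomb[OF Suc this, of 1 "d N"] show ?case
    by (simp only: mult_1 sum.lessThan_Suc)
qed

text \<open>The approximation has two stages, since the pointwise bound on \<open>f\<close> is too
  weak to dominate its own Taylor polynomials. The dilate \<open>F\<close> is close to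
  \<open>f\<close>, and the Taylor polynomials of \<open>F\<close> have the square integrable
  majorant \<open>w\<close>, with exponent \<open>s^2 / 2\<close>.\<close>

lemma fock_polynomial_dense:
  assumes f: "f \<in> fock_space" and "\<epsilon> > 0"
  shows "\<exists>N d. fock_norm (\<lambda>z. f z - (\<Sum>n<N. d n * z ^ n)) < \<epsilon>"
proof -
  obtain s :: "nat \<Rightarrow> real" where s: "\<And>j. 0 < s j" "\<And>j. s j < 1"
    and lim: "(\<lambda>j. (s j)\<^sup>2) \<longlonglongrightarrow> 1"
    using unit_squares_tendsto_1 by blast
  have r: "0 < (s j)\<^sup>2" "(s j)\<^sup>2 < 1" for j
    using s[of j] by (auto simp: power_less_one_iff)
  have "fock_tendsto (\<lambda>j. fock_dilation 0 0 ((s j)\<^sup>2) f) f"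
    by (intro fock_dilation_tendsto f r lim)
  then have "\<forall>\<^sub>F j in sequentially. fock_norm (\<lambda>z. fock_dilation 0 0 ((s j)\<^sup>2) f z - f z) < \<epsilon> / 2"
    unfolding fock_tendsto_def by (rule order_tendstoD(2)) (use \<open>\<epsilon> > 0\<close> in simp)
  then obtain j where j: "fock_norm (\<lambda>z. fock_dilation 0 0 ((s j)\<^sup>2) f z - f z) < \<epsilon> / 2"
    using eventually_happens trivial_limit_sequentially by blast
  define F where "F = fock_dilation 0 0 ((s j)\<^sup>2) f"
  have F: "F \<in> fock_space" unfolding F_def by (intro fock_dilation_bound f r)
  have F_eq: "F z = f (of_real ((s j)\<^sup>2) * z)" for z by (simp add: F_def fock_dilation_def)
  define d where "d n = (deriv ^^ n) f 0 / fact n * of_real ((s j)\<^sup>2) ^ n" for n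
  define p where "p N z = (\<Sum>n<N. d n * z ^ n)" for N z
  \<comment> \<open>Only the first half of domain membership is used here, that polynomials lie in
    the Fock space.\<close>
  have pF: "p N \<in> fock_space" for N unfolding p_def using polynomial_in_dom_exp_affine[of d N 0 0 0 0]
    by (simp only: W_max_simps)
  note [measurable] = fock_spaceD(2)[OF F] fock_spaceD(2)[OF pF]
  have p_lim: "(\<lambda>N. p N z) \<longlonglongrightarrow> F z" for z
    using entire_taylor_sums[OF fock_spaceD(1)[OF f], of 0 "of_real ((s j)\<^sup>2) * z"]
    by (simp add: sums_def p_def d_def F_eq power_mult_distrib mult.assoc)
  define w where "w z = fock_norm f / (1 - s j) * exp ((s j)\<^sup>2 / 2 * (cmod z)\<^sup>2 + 0 * cmod z)" for z
  have p_bound: "cmod (p N z) \<le> w z" for N z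
  proof -
    have "p N z = (\<Sum>n<N. (deriv ^^ n) f 0 / fact n * (of_real ((s j)\<^sup>2) * z) ^ n)"
      by (simp add: p_def d_def power_mult_distrib mult.assoc)
    then show ?thesis
      using entire_taylor_partial_sum_bound[OF fock_spaceD(1)[OF f] less_imp_le[OF s(1)] s(2) fock_pointwise_bound[OF f], where u = z and N = N]
      by (simp add: w_def power_mult_distrib)
  qed
  have F_bound: "cmod (F z) \<le> w z" for z
    by (rule LIMSEQ_le_const2[OF tendsto_norm[OF p_lim]]) (use p_bound in auto)
  have "(\<lambda>N. LINT z|gauss. (cmod (p N z - F z))\<^sup>2) \<longlonglongrightarrow> (LINT z|gauss. 0)"
  proof (rule integral_dominated_convergence)
    show "integrable gauss (\<lambda>z. 4 * (w z)\<^sup>2)"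
      unfolding w_def using r by (intro integrable_mult_right integrable_gauss_exp_square) simp
    show "AE z in gauss. (\<lambda>N. (cmod (p N z - F z))\<^sup>2) \<longlonglongrightarrow> 0"
    proof (rule AE_I2)
      fix z
      have "(\<lambda>N. (cmod (p N z - F z))\<^sup>2) \<longlonglongrightarrow> (cmod (F z - F z))\<^sup>2"
        by (intro tendsto_intros p_lim)
      then show "(\<lambda>N. (cmod (p N z - F z))\<^sup>2) \<longlonglongrightarrow> 0" by simp
    qed
    show "AE z in gauss. norm ((cmod (p N z - F z))\<^sup>2) \<le> 4 * (w z)\<^sup>2" for N
    proof (rule AE_I2)
      fix z
      have "(cmod (p N z))\<^sup>2 \<le> (w z)\<^sup>2" "(cmod (F z))\<^sup>2 \<le> (w z)\<^sup>2"
        using p_bound F_bound by (auto intro: power_mono)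
      then show "norm ((cmod (p N z - F z))\<^sup>2) \<le> 4 * (w z)\<^sup>2"
        using cmod_diff_squared_le[of "p N z" "F z"] by simp
    qed
  qed measurable
  then have "(\<lambda>N. sqrt (LINT z|gauss. (cmod (p N z - F z))\<^sup>2)) \<longlonglongrightarrow> sqrt 0"
    by (intro tendsto_real_sqrt) simp
  then have "(\<lambda>N. fock_norm (\<lambda>z. p N z - F z)) \<longlonglongrightarrow> 0"
    by (simp add: fock_norm_eq)
  then have "\<forall>\<^sub>F N in sequentially. fock_norm (\<lambda>z. p N z - F z) < \<epsilon> / 2"
    by (rule order_tendstoD(2)) (use \<open>\<epsilon> > 0\<close> in simp)
  then obtain N where N: "fock_norm (\<lambda>z. p N z - F z) < \<epsilon> / 2"
    using eventually_happens trivial_limit_sequentially by blast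
  have uF: "(\<lambda>z. p N z - F z) \<in> fock_space" and vF: "(\<lambda>z. F z - f z) \<in> fock_space"
    and fpF: "(\<lambda>z. f z - p N z) \<in> fock_space"
    by (intro fock_space_diff F f pF)+
  have "(fock_norm (\<lambda>z. f z - p N z))\<^sup>2 = (LINT z|gauss. (cmod (f z - p N z))\<^sup>2)"
    using fpF by (simp add: fock_norm_eq fock_spaceD)
  also have "\<dots> \<le> (LINT z|gauss. 2 * (cmod (p N z - F z))\<^sup>2 + 2 * (cmod (F z - f z))\<^sup>2)"
  proof (rule integral_mono)
    fix z
    have "f z - p N z = - (F z - f z) - (p N z - F z)" by simp
    then show "(cmod (f z - p N z))\<^sup>2 \<le> 2 * (cmod (p N z - F z))\<^sup>2 + 2 * (cmod (F z - f z))\<^sup>2"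
      using cmod_diff_squared_le[of "- (F z - f z)" "p N z - F z"] by (simp only: norm_minus_cancel add.commute)
  qed (use fock_spaceD(3)[OF uF] fock_spaceD(3)[OF vF] fock_spaceD(3)[OF fpF] in auto)
  also have "\<dots> = 2 * (fock_norm (\<lambda>z. p N z - F z))\<^sup>2 + 2 * (fock_norm (\<lambda>z. F z - f z))\<^sup>2"
    using fock_spaceD(2,3)[OF uF] fock_spaceD(2,3)[OF vF] by (simp add: fock_norm_eq)
  also have "\<dots> < 2 * (\<epsilon> / 2)\<^sup>2 + 2 * (\<epsilon> / 2)\<^sup>2"
    using N j fock_norm_nonneg[OF uF] fock_norm_nonneg[OF vF]
    by (intro add_strict_mono mult_strict_left_mono power_strict_mono) (auto simp: F_def)
  also have "\<dots> = \<epsilon>\<^sup>2" by (simp add: power2_eq_square)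
  finally have "fock_norm (\<lambda>z. f z - p N z) < \<epsilon>"
    by (rule power_less_imp_less_base) (use \<open>\<epsilon> > 0\<close> in simp)
  then show ?thesis unfolding p_def by blast
qed

lemma densely_defined_exp_affine:
  "densely_defined (W_max (\<lambda>z. C * exp (D * z)) (\<lambda>z. A * z + B))"
  unfolding densely_defined_def
proof (intro conjI ballI allI impI)
  fix f and \<epsilon> :: real assume "f \<in> fock_space" "\<epsilon> > 0"
  then obtain N d where "fock_norm (\<lambda>z. f z - (\<Sum>n<N. d n * z ^ n)) < \<epsilon>"
    using fock_polynomial_dense by blast
  then show "\<exists>g\<in>op_dom (W_max (\<lambda>z. C * exp (D * z)) (\<lambda>z. A * z + B)). fock_norm (\<lambda>z. f z - g z) < \<epsilon>"
    by (rule bexI[OF _ polynomial_in_dom_exp_affine])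
qed auto

lemma adjoint_exp_affine_dom:
  "g \<in> op_dom (adjoint_op (W_max (\<lambda>z. C * exp (D * z)) (\<lambda>z. A * z + B))) \<longleftrightarrow>
     g \<in> op_dom (W_max (\<lambda>z. cnj C * exp (cnj B * z)) (\<lambda>z. cnj A * z + cnj D))"
proof -
  let ?T = "W_max (\<lambda>z. C * exp (D * z)) (\<lambda>z. A * z + B)"
  note dense = densely_defined_exp_affine[of C D A B]
  show ?thesis
  proof
    assume g: "g \<in> op_dom (adjoint_op ?T)"
    have "g \<in> fock_space" "op_app (adjoint_op ?T) g \<in> fock_space"
      using adjoint_op_domE[OF dense W_max_range g] by blast+
    then show "g \<in> op_dom (W_max (\<lambda>z. cnj C * exp (cnj B * z)) (\<lambda>z. cnj A * z + cnj D))"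
      by (simp add: adjoint_exp_affine_app[OF dense g])
  next
    assume "g \<in> op_dom (W_max (\<lambda>z. cnj C * exp (cnj B * z)) (\<lambda>z. cnj A * z + cnj D))"
    then show "g \<in> op_dom (adjoint_op ?T)"
      using exp_affine_duality by (intro adjoint_op_app(1)[OF dense W_max_range]) auto
  qed
qed

section \<open>Sufficiency: the conjugation intertwines the operator with its adjoint\<close>

context fock_conjugation
begin

lemma weighted_comp_wc_conj:
  assumes D: "D = a * B - b * A + b"
  shows "weighted_comp (\<lambda>z. cnj C * exp (cnj B * z)) (\<lambda>z. cnj A * z + cnj D) (wc_conj a b c f) =
    wc_conj a b c (weighted_comp (\<lambda>z. C * exp (D * z)) (\<lambda>z. A * z + B) f)"
proof
  fix z
  \<comment> \<open>The relation for \<open>D\<close>, conjugated and multiplied by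
    \<open>a\<close>. It makes both the arguments of \<open>f\<close> and the exponents on the two
    sides match.\<close>
  have aD: "a * cnj D = cnj B + b * cnj A - b"
  proof -
    have "a * cnj D = (a * cnj a) * cnj B - (a * cnj b) * cnj A + a * cnj b"
      by (simp add: D algebra_simps del: cnj_a_a)
    also have "a * cnj b = - b" using b_eq by (metis minus_minus)
    finally show ?thesis by simp
  qed
  have 1: "a * (cnj A * z + cnj D) + b = cnj (A * cnj (a * z + b) + B)"
    by (simp add: algebra_simps aD)
  have 2: "cnj B * z + b * (cnj A * z + cnj D) = b * z + cnj D * (a * z + b)"
  proof -
    have "cnj D * (a * z + b) = (a * cnj D) * z + b * cnj D"
      by (simp add: algebra_simps)
    then show ?thesis unfolding aD by (simp add: algebra_simps)
  qed
  have "weighted_comp (\<lambda>z. cnj C * exp (cnj B * z)) (\<lambda>z. cnj A * z + cnj D) (wc_conj a b c f) z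
      = c * cnj C * exp (cnj B * z + b * (cnj A * z + cnj D)) * cnj (f (cnj (a * (cnj A * z + cnj D) + b)))"
    by (simp only: weighted_comp_def wc_conj_def exp_add mult_ac)
  also have "\<dots> = c * cnj C * exp (b * z + cnj D * (a * z + b)) * cnj (f (A * cnj (a * z + b) + B))"
    unfolding 1 2 by (simp only: complex_cnj_cnj)
  also have "\<dots> = wc_conj a b c (weighted_comp (\<lambda>z. C * exp (D * z)) (\<lambda>z. A * z + B) f) z"
    by (simp only: weighted_comp_def wc_conj_def exp_add complex_cnj_mult exp_cnj complex_cnj_cnj mult_ac)
  finally show "weighted_comp (\<lambda>z. cnj C * exp (cnj B * z)) (\<lambda>z. cnj A * z + cnj D) (wc_conj a b c f) z =
    wc_conj a b c (weighted_comp (\<lambda>z. C * exp (D * z)) (\<lambda>z. A * z + B) f) z" .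
qed

text \<open>With \<open>J\<close> the conjugation, \<open>S (J f) = J (T f)\<close>, and
  \<open>J\<close> preserves membership in the Fock space in both directions. Hence
  \<open>J f\<close> lies in the domain of \<open>S\<close>, which is that of the adjoint, exactly
  when \<open>f\<close> lies in the domain of \<open>T\<close>.\<close>

lemma conj_selfadjoint_exp_affine_dom:
  assumes D: "D = a * B - b * A + b"
  shows "conj_selfadjoint (wc_conj a b c) (W_max (\<lambda>z. C * exp (D * z)) (\<lambda>z. A * z + B))"
  unfolding conj_selfadjoint_def
proof (intro conjI closed_op_W_max densely_defined_exp_affine linear_op_W_max)
  let ?T = "W_max (\<lambda>z. C * exp (D * z)) (\<lambda>z. A * z + B)"
  let ?J = "wc_conj a b c"
  have dom: "f \<in> op_dom ?T \<longleftrightarrow> f \<in> fock_space \<and> ?J f \<in> op_dom (adjoint_op ?T)" for f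
    by (simp add: adjoint_exp_affine_dom weighted_comp_wc_conj[OF D] wc_conj_fock_space_iff)
  moreover have "op_app ?T f = ?J (op_app (adjoint_op ?T) (?J f))" if "f \<in> op_dom ?T" for f
  proof -
    have "?J f \<in> op_dom (adjoint_op ?T)" using that dom by blast
    from adjoint_exp_affine_app[OF densely_defined_exp_affine this] show ?thesis
      by (simp add: weighted_comp_wc_conj[OF D] wc_conj_involutive)
  qed
  ultimately show "op_eq ?T (sandwich_op ?J (adjoint_op ?T) ?J)"
    by (simp only: op_eq_def sandwich_op_def fock_op.simps set_eq_iff mem_Collect_eq) blast
qed

end

theorem theorem4p4:
  fixes a b c :: complex and \<psi> \<phi> :: "complex \<Rightarrow> complex"
  assumes "cmod a = 1"
    and "cnj a * b + cnj b = 0"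
    and "(cmod c)\<^sup>2 * exp ((cmod b)\<^sup>2) = 1"
    and "\<psi> holomorphic_on UNIV"
    and "\<phi> holomorphic_on UNIV"
    and "\<exists>z. \<psi> z \<noteq> 0"
  shows "(conj_selfadjoint (wc_conj a b c) (W_max \<psi> \<phi>) \<longleftrightarrow>
            densely_defined (W_max \<psi> \<phi>) \<and>
            adjoint_op (W_max \<psi> \<phi>) \<preceq>\<^sub>o\<^sub>p
              sandwich_op (wc_conj a b c) (W_max \<psi> \<phi>) (wc_conj a b c)) \<and>
         (densely_defined (W_max \<psi> \<phi>) \<and>
            adjoint_op (W_max \<psi> \<phi>) \<preceq>\<^sub>o\<^sub>p
              sandwich_op (wc_conj a b c) (W_max \<psi> \<phi>) (wc_conj a b c) \<longleftrightarrow>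
          (\<exists>A B C D. C \<noteq> 0 \<and> D = a * B - b * A + b \<and>
             (\<forall>z. \<phi> z = A * z + B) \<and> (\<forall>z. \<psi> z = C * exp (D * z))))"
    (is "(?selfadj \<longleftrightarrow> ?ext) \<and> (_ \<longleftrightarrow> ?symb)")
proof -
  interpret fock_conjugation a b c
    using assms(1-3) by unfold_locales
  have "?selfadj \<Longrightarrow> ?ext"
    using conj_selfadjoint_imp_adjoint_extends by (simp add: conj_selfadjoint_def)
  moreover have "?ext \<Longrightarrow> ?symb"
    using adjoint_extends_imp_symbols assms(4-6) by blast
  moreover have "?symb \<Longrightarrow> ?selfadj"
  proof -
    assume ?symb
    then obtain A B C D where "D = a * B - b * A + b"
      and "\<phi> = (\<lambda>z. A * z + B)" and "\<psi> = (\<lambda>z. C * exp (D * z))"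
      unfolding fun_eq_iff by blast
    then show ?selfadj using conj_selfadjoint_exp_affine_dom by simp
  qed
  ultimately show ?thesis by blast
qed

end
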